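(* Consider the singing protocol in the asynchronous model on a static network in which every agent starts in state $\textsc{Un}$. Let $T_{\max}$ be an upper bound on the round duration for any agent, $T_{\min}$ a lower bound on the round duration for any agent, and $\Delta_{\max}$ an upper bound on the transmission delay between any pair of neighboring agents, with $2\Delta_{\max}\le T_{\min}$. Let $T_{\mathrm{diff}}=2\Delta_{\max}+3T_{\max}$ and let ${\cal E}_t$ be the set of active edges at time $t$. Then for all times $t\ge0$, $$|{\cal E}_t| - \mathbb{E}\big[|{\cal E}_{t+T_{\mathrm{diff}}}|\big] \ge \frac{|{\cal E}_t|}{28}\cdot\frac{T_{\min}}{T_{\mathrm{diff}}},$$ where the expectation is over the $\ell$-values of rounds starting after time $t$.
   Context: Agents are the vertices of an undirected static communication graph; agents know nothing about the graph. Each agent is in a state in $\{\textsc{Out},\textsc{In},\textsc{Un}\}$. Asynchronous model: each agent $v$ runs rounds $(v,0),(v,1),\dots$; round $(v,i)$ starts at time $t_{v,i}$ and ends at time $t_{v,i+1}$. The state $s_{v,i}$ is fixed during round $(v,i)$, and the state of $v$ at time $t\in[t_{v,i},t_{v,i+1})$ is $s_{v,i}$. A note sung by $u$ from time $a$ to $b$ is heard by a neighbor $v$ from time $a+\delta$ to $b+\delta$, with delay $\delta\le\Delta_{\max}$ (possibly varying over time and between pairs, independent of the notes). Round durations lie in $[T_{\min},T_{\max}]$ and may vary; a round's duration may depend on all information available to the agent before the round begins but is determined before the round begins (it cannot depend on that round's $\ell$-value or on transmissions in it). In a round, an agent hears the union of notes from its neighbors that reach it during the round (presence only, not multiplicity).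 Singing protocol (round $(v,i)$, state $s$): compute a fresh $\ell$-value by flipping a fair coin until the first $0$, $\ell$ = number of flips (independent of everything else). If $s=\textsc{Out}$ sing nothing; if $s=\textsc{In}$ sing note $0$; if $s=\textsc{Un}$ sing notes $1,\dots,\ell$. All agents listen for note $0$; $\textsc{Un}$ agents also listen for note $\ell$. End of round: $\textsc{In}$ becomes $\textsc{Un}$ if it heard $0$, else stays $\textsc{In}$; $\textsc{Un}$ becomes $\textsc{Out}$ if it heard $0$, otherwise stays $\textsc{Un}$ if it heard note $\ell$ and becomes $\textsc{In}$ if not; $\textsc{Out}$ stays $\textsc{Out}$ if it heard $0$, else becomes $\textsc{Un}$. At time $t$, an agent is $\textsc{In}^{\overline{\textsc{In}}}$ if its state at time $t$ is $\textsc{In}$ and no neighbor's state at time $t$ is $\textsc{In}$. An agent is eliminated at time $t$ if it is $\textsc{In}^{\overline{\textsc{In}}}$ or adjacent to an $\textsc{In}^{\overline{\textsc{In}}}$ agent at time $t$; otherwise active. An edge is eliminated at time $t$ if some endpoint is eliminated, otherwise active. *)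

theory Defs
  imports "HOL-Probability.Probability"
begin

text \<open>\<open>Undecided\<close> is the state \<open>Un\<close>, a name that the ASCII syntax for unions reserves.\<close>

datatype agent_state = Out | In | Undecided

text \<open>
  The communication graph is given by its edge set \<open>E\<close> on a finite type of agents, every edge
  being a two-element set; in particular \<open>{v, v} \<notin> E\<close>.  Rounds are pairs \<open>(v, i)\<close>, and an outcome
  \<open>\<omega> :: 'v \<times> nat \<Rightarrow> nat\<close> assigns to each round its \<open>\<ell>\<close>-value.
\<close>

fun notes_sung :: "agent_state \<Rightarrow> nat \<Rightarrow> nat set" where
  "notes_sung Out l = {}"
| "notes_sung In l = {0}"
| "notes_sung Undecided l = {1..l}"

fun next_state :: "agent_state \<Rightarrow> nat \<Rightarrow> nat set \<Rightarrow> agent_state" where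
  "next_state In l H = (if 0 \<in> H then Undecided else In)"
| "next_state Undecided l H = (if 0 \<in> H then Out else if l \<in> H then Undecided else In)"
| "next_state Out l H = (if 0 \<in> H then Out else Undecided)"

text \<open>Start time and state of every round.\<close>

record 'v execution =
  start :: "'v \<Rightarrow> nat \<Rightarrow> real"
  state :: "'v \<Rightarrow> nat \<Rightarrow> agent_state"

text \<open>
  The song of round \<open>(u, j)\<close> reaches \<open>v\<close> with the delay in force for the pair \<open>(u, v)\<close> at the moment
  the song begins; \<open>delay\<close> is a fixed function, so it cannot depend on the notes.

  Songs fill half-open intervals, as states do, while \<open>v\<close> listens on the closed interval from the
  start to the end of its round.  The closed right end matters: if a song that arrives exactly
  when the round ends were missed, then for \<open>2 * \<Delta>max = Tmin\<close> two neighbours could both become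
  \<open>In\<close>, and an eliminated edge could become active again.  The requirement that the song begins strictly
  before the listening round ends only matters for delay \<open>0\<close>: there, the state entered by \<open>u\<close> at
  the very instant at which the round of \<open>v\<close> ends must not influence that round.
\<close>

definition reaches ::
  "('v \<Rightarrow> 'v \<Rightarrow> real \<Rightarrow> real) \<Rightarrow> 'v execution \<Rightarrow> 'v \<Rightarrow> nat \<Rightarrow> 'v \<Rightarrow> nat \<Rightarrow> bool" where
  "reaches delay X u j v i \<longleftrightarrow>
     (let \<delta> = delay u v (start X u j) in
        start X u j < start X v (Suc i) \<and>
        {start X u j + \<delta> ..< start X u (Suc j) + \<delta>} \<inter> {start X v i .. start X v (Suc i)} \<noteq> {})"

definition heard ::
  "'v set set \<Rightarrow> ('v \<Rightarrow> 'v \<Rightarrow> real \<Rightarrow> real) \<Rightarrow> ('v \<times> nat \<Rightarrow> nat) \<Rightarrow> 'v execution \<Rightarrow> 'v \<Rightarrow> nat \<Rightarrow> nat set" where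
  "heard E delay \<omega> X v i =
     \<Union> {notes_sung (state X u j) (\<omega> (u, j)) | u j. {u, v} \<in> E \<and> reaches delay X u j v i}"

text \<open>
  Everything agent \<open>v\<close> can know when round \<open>(v, i)\<close> begins: its states, its \<open>\<ell>\<close>-values and the notes it
  heard in the previous rounds.  Its current state, and the start times of its rounds up to \<open>(v, i)\<close>,
  are functions of this list.
\<close>

definition local_history ::
  "'v set set \<Rightarrow> ('v \<Rightarrow> 'v \<Rightarrow> real \<Rightarrow> real) \<Rightarrow> ('v \<times> nat \<Rightarrow> nat) \<Rightarrow> 'v execution \<Rightarrow> 'v \<Rightarrow> nat
     \<Rightarrow> (agent_state \<times> nat \<times> nat set) list" where
  "local_history E delay \<omega> X v i =
     map (\<lambda>j. (state X v j, \<omega> (v, j), heard E delay \<omega> X v j)) [0..<i]"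

text \<open>
  \<open>X\<close> is the run of the protocol from all-\<open>Undecided\<close> when the \<open>\<ell>\<close>-values are \<open>\<omega>\<close>, agent \<open>v\<close> starts at time
  \<open>t0 v\<close> and chooses its round durations by the rule \<open>dur v\<close>.  If all durations are at least some
  \<open>Tmin > 0\<close> and delays are nonnegative, there is exactly one such \<open>X\<close>: whether and how rounds end
  at a time \<open>\<tau>\<close> depends only on rounds started before \<open>\<tau>\<close>, of which there are finitely many.
\<close>

definition is_execution ::
  "'v set set \<Rightarrow> ('v \<Rightarrow> 'v \<Rightarrow> real \<Rightarrow> real) \<Rightarrow> ('v \<Rightarrow> real)
     \<Rightarrow> ('v \<Rightarrow> (agent_state \<times> nat \<times> nat set) list \<Rightarrow> real)
     \<Rightarrow> ('v \<times> nat \<Rightarrow> nat) \<Rightarrow> 'v execution \<Rightarrow> bool" where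
  "is_execution E delay t0 dur \<omega> X \<longleftrightarrow>
     (\<forall>v. start X v 0 = t0 v \<and> state X v 0 = Undecided) \<and>
     (\<forall>v i. start X v (Suc i) = start X v i + dur v (local_history E delay \<omega> X v i) \<and>
            state X v (Suc i) = next_state (state X v i) (\<omega> (v, i)) (heard E delay \<omega> X v i))"

definition state_at :: "'v execution \<Rightarrow> 'v \<Rightarrow> real \<Rightarrow> agent_state" where
  "state_at X v t = state X v (THE i. start X v i \<le> t \<and> t < start X v (Suc i))"

definition lone_In :: "'v set set \<Rightarrow> 'v execution \<Rightarrow> 'v \<Rightarrow> real \<Rightarrow> bool" where
  "lone_In E X v t \<longleftrightarrow> state_at X v t = In \<and> (\<forall>u. {u, v} \<in> E \<longrightarrow> state_at X u t \<noteq> In)"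

definition eliminated :: "'v set set \<Rightarrow> 'v execution \<Rightarrow> 'v \<Rightarrow> real \<Rightarrow> bool" where
  "eliminated E X v t \<longleftrightarrow> lone_In E X v t \<or> (\<exists>u. {u, v} \<in> E \<and> lone_In E X u t)"

definition active_edges :: "'v set set \<Rightarrow> 'v execution \<Rightarrow> real \<Rightarrow> 'v set set" where
  "active_edges E X t = {e \<in> E. \<forall>v\<in>e. \<not> eliminated E X v t}"

text \<open>
  \<open>geometric_pmf (1/2)\<close> counts the flips before the first \<open>0\<close>; the \<open>\<ell>\<close>-value includes the last flip.
\<close>

definition ell_pmf :: "nat pmf" where
  "ell_pmf = map_pmf Suc (geometric_pmf (1/2))"

definition ell_measure :: "('v \<times> nat \<Rightarrow> nat) measure" where
  "ell_measure = (\<Pi>\<^sub>M r\<in>UNIV. measure_pmf ell_pmf)"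

text \<open>Keep the \<open>\<ell>\<close>-values of the rounds of \<open>X\<close> started up to time \<open>t\<close>; take all others from \<open>\<omega>'\<close>.\<close>

definition resample_after ::
  "real \<Rightarrow> 'v execution \<Rightarrow> ('v \<times> nat \<Rightarrow> nat) \<Rightarrow> ('v \<times> nat \<Rightarrow> nat) \<Rightarrow> ('v \<times> nat \<Rightarrow> nat)" where
  "resample_after t X \<omega> \<omega>' = (\<lambda>(v, i). if start X v i \<le> t then \<omega> (v, i) else \<omega>' (v, i))"

end

theory Submission
  imports Defs
begin

text \<open>
  As \<open>2 * \<Delta>max \<le> Tmin\<close>, two neighbours whose rounds end within \<open>\<Delta>max\<close> of each other hear each other, so
  no two neighbours are ever both \<open>In\<close>.  Hence \<open>In\<close> is permanent, an agent is \<open>Out\<close> only next to an \<open>In\<close>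
  agent, and the active agents are \<open>Undecided\<close>.

  Consider an edge \<open>{u, v}\<close> active at time \<open>t\<close>, and let the special round of \<open>u\<close> be its first one beginning after
  \<open>t + 2 * \<Delta>max + Tmax\<close>.  Its competitors are the first \<open>R = \<lceil>Tdiff / Tmin\<rceil>\<close> fresh rounds of each active
  neighbour of \<open>u\<close> or \<open>v\<close>, a set of \<open>n \<le> R * (d u + d v)\<close> rounds that is fixed at time \<open>t\<close>.  If the \<open>\<ell>\<close>-value of
  the special round is above a threshold \<open>j \<approx> log n\<close>, all other competitors are at most \<open>j\<close>, and no neighbour
  of \<open>u\<close> joins before it can hear the special round, then \<open>u\<close> becomes \<open>In\<close> and all active edges at \<open>v\<close> are eliminated.
  Which round is special depends on earlier \<open>\<ell>\<close>-values, but not on its own; redrawing only the latter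
  gives this event probability at least \<open>(1 / 2 - q u) / (4 * n)\<close>, where \<open>q u\<close> is the probability that \<open>u\<close> is
  eliminated by \<open>t + Tdiff\<close>.  For fixed \<open>v\<close> these events are disjoint, so summing over \<open>u\<close> bounds \<open>q v\<close> from
  below, and summing \<open>d v * q v\<close> over \<open>v\<close> counts each edge at most twice.  For the expected number \<open>z\<close> of
  eliminated edges among \<open>m\<close> active ones this gives \<open>m / 2 - z \<le> 8 * R * z\<close>; the terms \<open>q u\<close> are absorbed in \<open>z\<close>.
\<close>

section \<open>Independent \<open>\<ell>\<close>-values\<close>

lemma ell_pmf_tail: "measure_pmf.prob ell_pmf {n. j < n} = (1 / 2) ^ j"
proof -
  have "measure_pmf.prob (geometric_pmf (1 / 2)) {..<j} = (\<Sum>k<j. (1 / 2) ^ Suc k)"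
    by (simp add: measure_measure_pmf_finite)
  also have "\<dots> = 1 - (1 / 2) ^ j"
    by (induction j) (auto simp: field_simps)
  finally have "measure_pmf.prob (geometric_pmf (1 / 2)) (UNIV - {..<j}) = (1 / 2) ^ j"
    using measure_pmf.prob_compl[of "{..<j}" "geometric_pmf (1 / 2)"] by simp
  moreover have "Suc -` {n. j < n} = UNIV - {..<j}" by auto
  ultimately show ?thesis by (simp add: ell_pmf_def)
qed

lemma ell_pmf_ge_1: "n \<in> set_pmf ell_pmf \<Longrightarrow> 1 \<le> n"
  by (auto simp: ell_pmf_def)

lemma prob_Pi_pmf_tail:
  assumes "finite J" "r \<in> J"
  shows "measure_pmf.prob (Pi_pmf J d (\<lambda>_. ell_pmf)) {\<xi>. j < \<xi> r} = (1 / 2) ^ j"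
proof -
  have "map_pmf (\<lambda>\<xi>. \<xi> r) (Pi_pmf J d (\<lambda>_. ell_pmf)) = ell_pmf"
    using assms by (simp add: Pi_pmf_component)
  then have "measure_pmf.prob ell_pmf {n. j < n} =
      measure_pmf.prob (Pi_pmf J d (\<lambda>_. ell_pmf)) ((\<lambda>\<xi>. \<xi> r) -` {n. j < n})"
    by (metis measure_map_pmf)
  then show ?thesis by (simp add: ell_pmf_tail vimage_def)
qed

text \<open>Both sides draw the coordinate \<open>r\<close> independently of those in
  \<open>J - {r}\<close>; overwriting erases the old value at \<open>r\<close>.\<close>

lemma Pi_pmf_resample:
  assumes "finite J" "r \<in> J"
  shows "map_pmf (\<lambda>(m, \<xi>). \<xi>(r := m)) (pair_pmf (p r) (Pi_pmf J d p)) = Pi_pmf J d p"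
proof -
  have "Pi_pmf J d p = Pi_pmf (insert r (J - {r})) d p"
    using assms by (simp add: insert_absorb)
  also have "\<dots> = map_pmf (\<lambda>(m, \<xi>). \<xi>(r := m))
      (pair_pmf (p r) (map_pmf (\<lambda>\<xi>. \<xi>(r := d)) (Pi_pmf J d p)))"
    using assms by (subst Pi_pmf_insert) (auto simp: Pi_pmf_remove)
  also have "\<dots> = map_pmf (\<lambda>(m, \<xi>). \<xi>(r := m)) (pair_pmf (p r) (Pi_pmf J d p))"
    by (simp add: pair_map_pmf2 map_pmf_comp case_prod_unfold apsnd_def map_prod_def)
  finally show ?thesis by simp
qed

text \<open>Independence enters the argument only in this form.\<close>

lemma prob_Pi_pmf_resample_ge:
  assumes J: "finite J" "r \<in> J"
    and imp: "\<And>\<xi> m. \<xi> \<in> set_pmf (Pi_pmf J d p) \<Longrightarrow> \<xi> \<in> A \<Longrightarrow> m \<in> set_pmf (p r) \<Longrightarrow> m \<in> M \<Longrightarrow>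
      \<xi>(r := m) \<in> B"
  shows "measure_pmf.prob (p r) M * measure_pmf.prob (Pi_pmf J d p) A
    \<le> measure_pmf.prob (Pi_pmf J d p) B"
proof -
  let ?P = "Pi_pmf J d p"
  \<comment> \<open>The supports are countable, as the product rule requires, and \<open>imp\<close>
    speaks of support points only.\<close>
  have "measure_pmf.prob (p r) M * measure_pmf.prob ?P A =
      measure_pmf.prob (p r) (M \<inter> set_pmf (p r)) * measure_pmf.prob ?P (A \<inter> set_pmf ?P)"
    by (simp add: measure_Int_set_pmf)
  also have "\<dots> = measure_pmf.prob (pair_pmf (p r) ?P) ((M \<inter> set_pmf (p r)) \<times> (A \<inter> set_pmf ?P))"
    by (rule measure_pmf_prob_product[symmetric]) auto
  also have "\<dots> \<le> measure_pmf.prob (pair_pmf (p r) ?P) ((\<lambda>(m, \<xi>). \<xi>(r := m)) -` B)"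
    using imp by (intro measure_pmf.finite_measure_mono) auto
  also have "\<dots> = measure_pmf.prob (map_pmf (\<lambda>(m, \<xi>). \<xi>(r := m)) (pair_pmf (p r) ?P)) B"
    by simp
  finally show ?thesis
    by (simp only: Pi_pmf_resample[OF J])
qed

text \<open>Projecting to the coordinates in \<open>J\<close> turns the infinite product into
  \<open>Pi_pmf\<close>, and \<open>f\<close> factors through this projection.\<close>

lemma integral_ell_measure_eq_expectation:
  fixes f :: "('v \<times> nat \<Rightarrow> nat) \<Rightarrow> real"
  assumes J: "finite J" and f: "\<And>\<xi> \<xi>'. (\<And>r. r \<in> J \<Longrightarrow> \<xi> r = \<xi>' r) \<Longrightarrow> f \<xi> = f \<xi>'"
  shows "(\<integral>\<xi>. f \<xi> \<partial>ell_measure) = measure_pmf.expectation (Pi_pmf J d (\<lambda>_. ell_pmf)) f"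
proof -
  interpret product_prob_space "\<lambda>_ :: 'v \<times> nat. measure_pmf ell_pmf" UNIV
    by standard
  define \<phi> :: "('v \<times> nat \<Rightarrow> nat) \<Rightarrow> ('v \<times> nat \<Rightarrow> nat)" where
    "\<phi> \<xi> = (\<lambda>r. if r \<in> J then \<xi> r else d)" for \<xi>
  define C :: "('v \<times> nat \<Rightarrow> nat) set" where "C = PiE_dflt J d (\<lambda>_. UNIV)"
  have C: "\<phi> \<xi> \<in> C" for \<xi> by (simp add: \<phi>_def C_def PiE_dflt_def)
  have cC: "countable C"
  proof -
    have "C = (\<lambda>h x. if x \<in> J then h x else d) ` (Pi\<^sub>E J (\<lambda>_. UNIV))"
      unfolding C_def by (rule dflt_image_PiE[symmetric])
    moreover have "countable (Pi\<^sub>E J (\<lambda>_. UNIV :: nat set))"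
      using J by (intro countable_PiE) auto
    ultimately show ?thesis by simp
  qed
  have sp: "space (ell_measure :: ('v \<times> nat \<Rightarrow> nat) measure) = UNIV"
    by (simp add: ell_measure_def space_PiM)
  have fibre: "\<phi> -` {c} = {\<xi> \<in> space ell_measure. \<forall>r\<in>J. \<xi> r \<in> {c r}}" if "c \<in> C" for c
    using that by (auto simp: \<phi>_def C_def PiE_dflt_def sp fun_eq_iff)
  have sets_fibre: "\<phi> -` {c} \<in> sets ell_measure" if "c \<in> C" for c
    unfolding fibre[OF that] ell_measure_def using J
    by (intro sets.sets_Collect_finite_All) (auto intro!: measurable_sets_Collect)
  have meas: "\<phi> \<in> measurable ell_measure (count_space UNIV)"
  proof (rule measurableI)
    fix A :: "('v \<times> nat \<Rightarrow> nat) set"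
    have "\<phi> -` A \<inter> space ell_measure = (\<Union>c\<in>A \<inter> C. \<phi> -` {c})"
      using C by (auto simp: sp)
    also have "\<dots> \<in> sets ell_measure"
      using cC sets_fibre by (intro sets.countable_UN') auto
    finally show "\<phi> -` A \<inter> space ell_measure \<in> sets ell_measure" .
  qed simp
  \<comment> \<open>Both measures are concentrated on the countable set \<open>C\<close>, so
    comparing point masses suffices.\<close>
  have "distr ell_measure (count_space UNIV) \<phi> = measure_pmf (Pi_pmf J d (\<lambda>_. ell_pmf))"
  proof (rule measure_eqI_countable_AE[OF _ _ _ _ cC])
    show "AE x in distr ell_measure (count_space UNIV) \<phi>. x \<in> C"
      using meas C by (subst AE_distr_iff) auto
    show "AE x in measure_pmf (Pi_pmf J d (\<lambda>_. ell_pmf)). x \<in> C"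
      using set_Pi_pmf_subset[OF J, of d "\<lambda>_. ell_pmf"]
      by (auto simp: AE_measure_pmf_iff C_def PiE_dflt_def)
    fix c assume c: "c \<in> C"
    have "emeasure (distr ell_measure (count_space UNIV) \<phi>) {c} = emeasure ell_measure (\<phi> -` {c})"
      using meas sp by (simp add: emeasure_distr)
    also have "\<dots> = (\<Prod>r\<in>J. emeasure (measure_pmf ell_pmf) {c r})"
      unfolding fibre[OF c] ell_measure_def using J by (intro emeasure_PiM_Collect) auto
    also have "\<dots> = (\<Prod>r\<in>J. ennreal (pmf ell_pmf (c r)))"
      by (simp add: emeasure_pmf_single)
    also have "\<dots> = ennreal (\<Prod>r\<in>J. pmf ell_pmf (c r))"
      by (simp add: prod_ennreal)
    also have "\<dots> = emeasure (measure_pmf (Pi_pmf J d (\<lambda>_. ell_pmf))) {c}"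
      using J c by (subst emeasure_pmf_single, subst pmf_Pi') (auto simp: C_def PiE_dflt_def)
    finally show "emeasure (distr ell_measure (count_space UNIV) \<phi>) {c} =
      emeasure (measure_pmf (Pi_pmf J d (\<lambda>_. ell_pmf))) {c}" .
  qed simp_all
  then have "measure_pmf.expectation (Pi_pmf J d (\<lambda>_. ell_pmf)) f = (\<integral>\<xi>. f (\<phi> \<xi>) \<partial>ell_measure)"
    using integral_distr[OF meas, of f] by simp
  also have "(\<lambda>\<xi>. f (\<phi> \<xi>)) = f"
    by (rule ext, rule f) (simp add: \<phi>_def)
  finally show ?thesis by simp
qed

section \<open>Counting edges\<close>

lemma power_of_two_between:
  assumes "1 \<le> (n :: nat)"
  obtains j where "n \<le> 2 ^ j" "2 ^ j \<le> 2 * n"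
proof
  define j where "j = (LEAST j. n \<le> 2 ^ j)"
  have "n \<le> 2 ^ n" by (simp add: less_imp_le)
  then show 1: "n \<le> 2 ^ j" unfolding j_def by (rule LeastI)
  show "2 ^ j \<le> 2 * n"
  proof (cases j)
    case 0
    with assms show ?thesis by simp
  next
    case (Suc k)
    then have "\<not> n \<le> 2 ^ k" using not_less_Least[of k "\<lambda>j. n \<le> 2 ^ j"] j_def by simp
    with Suc show ?thesis by simp
  qed
qed

definition nbrs :: "'v set set \<Rightarrow> 'v \<Rightarrow> 'v set" where
  "nbrs A v = {u. {u, v} \<in> A}"

lemma nbrs_sym: "u \<in> nbrs A v \<longleftrightarrow> v \<in> nbrs A u"
  by (simp add: nbrs_def insert_commute)

text \<open>Double counting: every edge is seen from each of its two endpoints.\<close>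

lemma sum_nbrs_eq_sum_edges:
  fixes A :: "'v::finite set set" and g :: "'v set \<Rightarrow> real"
  assumes card2: "\<And>e. e \<in> A \<Longrightarrow> card e = 2"
  shows "(\<Sum>v\<in>UNIV. \<Sum>u\<in>nbrs A v. g {u, v}) = 2 * sum g A"
proof -
  have "(\<Sum>u\<in>nbrs A v. g {u, v}) = sum g {e \<in> A. v \<in> e}" for v
  proof (rule sum.reindex_cong[symmetric])
    show "inj_on (\<lambda>u. {u, v}) (nbrs A v)"
      by (auto simp: inj_on_def doubleton_eq_iff)
    show "{e \<in> A. v \<in> e} = (\<lambda>u. {u, v}) ` nbrs A v"
    proof safe
      fix e assume e: "e \<in> A" "v \<in> e"
      with card2 obtain a b where "e = {a, b}" by (metis card_2_iff)
      with e show "e \<in> (\<lambda>u. {u, v}) ` nbrs A v"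
        by (auto simp: nbrs_def insert_commute)
    qed (auto simp: nbrs_def)
  qed simp
  then have "(\<Sum>v\<in>UNIV. \<Sum>u\<in>nbrs A v. g {u, v}) = (\<Sum>v\<in>UNIV. sum g {e \<in> A. v \<in> e})"
    by simp
  also have "\<dots> = (\<Sum>e\<in>A. \<Sum>v\<in>{v. v \<in> e}. g e)"
    using sum.swap_restrict[of UNIV A "\<lambda>v e. g e" "\<lambda>v e. v \<in> e"] by simp
  also have "\<dots> = 2 * sum g A"
    unfolding sum_distrib_left by (rule sum.cong) (auto simp: card2)
  finally show ?thesis .
qed

text \<open>
  \<open>Z e\<close> and \<open>q v\<close> will be the probabilities that an edge and an agent get eliminated; the assumption on
  \<open>q\<close> is what the agents \<open>u\<close> next to \<open>v\<close> contribute to the elimination of \<open>v\<close>.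
\<close>

lemma sum_edges_lower_bound:
  fixes A :: "'v::finite set set" and Z :: "'v set \<Rightarrow> real" and q :: "'v \<Rightarrow> real"
  defines "d \<equiv> \<lambda>v. real (card (nbrs A v))"
  assumes card2: "\<And>e. e \<in> A \<Longrightarrow> card e = 2"
    and q_le: "\<And>e v. e \<in> A \<Longrightarrow> v \<in> e \<Longrightarrow> q v \<le> Z e"
    and q_ge: "\<And>v. (\<Sum>u\<in>nbrs A v. c * (1 / 2 - Z {u, v}) / (d u + d v)) \<le> q v"
  shows "c * (card A / 2 - sum Z A) \<le> 2 * sum Z A"
proof -
  define h where "h e = c * (1 / 2 - Z e)" for e
  \<comment> \<open>With the weight \<open>d v\<close>, the terms of the ordered pairs
    \<open>(u, v)\<close> and \<open>(v, u)\<close> add up to \<open>h {u, v}\<close>, which removes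
    the degrees.\<close>
  define S where "S = (\<Sum>v\<in>UNIV. \<Sum>u\<in>nbrs A v. d v * (h {u, v} / (d u + d v)))"
  have pos: "0 < d v" if "u \<in> nbrs A v" for u v
    using that unfolding d_def by (auto simp: card_gt_0_iff)
  have "S = (\<Sum>v\<in>UNIV. \<Sum>u\<in>nbrs A v. d u * (h {u, v} / (d u + d v)))"
  proof -
    have "S = (\<Sum>v\<in>UNIV. \<Sum>u\<in>{u \<in> UNIV. u \<in> nbrs A v}. d v * (h {u, v} / (d u + d v)))"
      unfolding S_def by simp
    also have "\<dots> = (\<Sum>u\<in>UNIV. \<Sum>v\<in>{v \<in> UNIV. u \<in> nbrs A v}. d v * (h {u, v} / (d u + d v)))"
      by (rule sum.swap_restrict) auto
    also have "\<dots> = (\<Sum>u\<in>UNIV. \<Sum>v\<in>nbrs A u. d v * (h {v, u} / (d v + d u)))"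
      by (intro sum.cong) (auto simp: nbrs_def insert_commute add.commute)
    finally show ?thesis .
  qed
  then have "2 * S = (\<Sum>v\<in>UNIV. \<Sum>u\<in>nbrs A v.
      d v * (h {u, v} / (d u + d v)) + d u * (h {u, v} / (d u + d v)))"
    by (simp add: S_def sum.distrib)
  also have "\<dots> = (\<Sum>v\<in>UNIV. \<Sum>u\<in>nbrs A v. h {u, v})"
  proof (intro sum.cong refl)
    fix v u assume "u \<in> nbrs A v"
    then have "0 < d u + d v" using pos nbrs_sym by (metis add_pos_pos)
    then show "d v * (h {u, v} / (d u + d v)) + d u * (h {u, v} / (d u + d v)) = h {u, v}"
      by (simp add: add_divide_distrib[symmetric] distrib_right[symmetric] add.commute)
  qed
  also have "\<dots> = 2 * sum h A" by (rule sum_nbrs_eq_sum_edges[OF card2])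
  finally have S: "S = c * (card A / 2 - sum Z A)"
    unfolding h_def by (simp add: sum_distrib_left[symmetric] sum_subtractf)
  have "S = (\<Sum>v\<in>UNIV. d v * (\<Sum>u\<in>nbrs A v. h {u, v} / (d u + d v)))"
    by (simp add: S_def sum_distrib_left)
  also have "\<dots> \<le> (\<Sum>v\<in>UNIV. d v * q v)"
    using q_ge unfolding h_def d_def by (intro sum_mono mult_left_mono) auto
  also have "\<dots> = (\<Sum>v\<in>UNIV. \<Sum>u\<in>nbrs A v. q v)" by (simp add: d_def)
  also have "\<dots> \<le> (\<Sum>v\<in>UNIV. \<Sum>u\<in>nbrs A v. Z {u, v})"
    by (intro sum_mono q_le) (auto simp: nbrs_def)
  also have "\<dots> = 2 * sum Z A" by (rule sum_nbrs_eq_sum_edges[OF card2])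
  finally show ?thesis by (simp add: S)
qed

section \<open>Executions and causality\<close>

text \<open>One run \<open>X \<eta>\<close> is fixed for each assignment \<open>\<eta>\<close>, so
  that runs differing in some \<open>\<ell>\<close>-values can be compared.
  \<open>delay_bound_nonneg\<close> follows from \<open>delays\<close> once there is an
  edge.\<close>

locale singing_protocol =
  fixes E :: "'v::finite set set"
    and delay :: "'v \<Rightarrow> 'v \<Rightarrow> real \<Rightarrow> real"
    and t0 :: "'v \<Rightarrow> real"
    and dur :: "'v \<Rightarrow> (agent_state \<times> nat \<times> nat set) list \<Rightarrow> real"
    and X :: "('v \<times> nat \<Rightarrow> nat) \<Rightarrow> 'v execution"
    and Tmin Tmax \<Delta>max :: real
  assumes card_edge: "\<And>e. e \<in> E \<Longrightarrow> card e = 2"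
    and delays: "\<And>u v \<tau>. {u, v} \<in> E \<Longrightarrow> 0 \<le> delay u v \<tau> \<and> delay u v \<tau> \<le> \<Delta>max"
    and durations: "\<And>v h. Tmin \<le> dur v h \<and> dur v h \<le> Tmax"
    and Tmin_pos: "0 < Tmin"
    and delay_bound: "2 * \<Delta>max \<le> Tmin"
    and delay_bound_nonneg: "0 \<le> \<Delta>max"
    and runs: "\<And>\<eta>. is_execution E delay t0 dur \<eta> (X \<eta>)"
begin

abbreviation "st \<eta> \<equiv> start (X \<eta>)"
abbreviation "sta \<eta> \<equiv> state (X \<eta>)"
abbreviation "hrd \<eta> \<equiv> heard E delay \<eta> (X \<eta>)"
abbreviation "hist \<eta> \<equiv> local_history E delay \<eta> (X \<eta>)"

lemma st_0: "st \<eta> v 0 = t0 v"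
  and sta_0: "sta \<eta> v 0 = Undecided"
  and st_Suc: "st \<eta> v (Suc i) = st \<eta> v i + dur v (hist \<eta> v i)"
  and sta_Suc: "sta \<eta> v (Suc i) = next_state (sta \<eta> v i) (\<eta> (v, i)) (hrd \<eta> v i)"
  using runs[of \<eta>] unfolding is_execution_def by auto

lemma st_Suc_ge: "st \<eta> v i + Tmin \<le> st \<eta> v (Suc i)"
  and st_Suc_le: "st \<eta> v (Suc i) \<le> st \<eta> v i + Tmax"
  using durations[of v "hist \<eta> v i"] by (auto simp: st_Suc)

lemma Tmin_le_Tmax: "Tmin \<le> Tmax"
  using durations[of undefined undefined] by linarith

lemma st_add_ge: "st \<eta> v i + real k * Tmin \<le> st \<eta> v (i + k)"
proof (induction k)
  case (Suc k)
  then show ?case using st_Suc_ge[of \<eta> v "i + k"] by (simp add: algebra_simps)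
qed simp

lemma strict_mono_st: "strict_mono (st \<eta> v)"
  unfolding strict_mono_Suc_iff
proof
  fix i show "st \<eta> v i < st \<eta> v (Suc i)"
    using st_Suc_ge[of \<eta> v i] Tmin_pos by linarith
qed

lemmas st_less_iff = strict_mono_less[OF strict_mono_st]
  and st_le_iff = strict_mono_less_eq[OF strict_mono_st]

lemma ex_round:
  assumes "st \<eta> v j \<le> \<tau>"
  shows "\<exists>i\<ge>j. st \<eta> v i \<le> \<tau> \<and> \<tau> < st \<eta> v (Suc i)"
proof -
  obtain k where "(\<tau> - st \<eta> v j) / Tmin < real k"
    using reals_Archimedean2 by blast
  then have "\<tau> < st \<eta> v j + real k * Tmin"
    using Tmin_pos by (simp add: field_simps)
  then have "\<tau> < st \<eta> v (j + k)"
    using st_add_ge[of \<eta> v j k] by linarith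
  with assms have "\<exists>i\<ge>j. i < j + k \<and> st \<eta> v i \<le> \<tau> \<and> \<tau> < st \<eta> v (Suc i)"
  proof (induction k)
    case (Suc k)
    then show ?case
    proof (cases "\<tau> < st \<eta> v (j + k)")
      case True
      with Suc show ?thesis using less_SucI by force
    next
      case False
      with Suc.prems show ?thesis by (intro exI[of _ "j + k"]) auto
    qed
  qed simp
  then show ?thesis by blast
qed

lemma round_unique:
  assumes "st \<eta> v i \<le> \<tau>" "\<tau> < st \<eta> v (Suc i)" "st \<eta> v j \<le> \<tau>" "\<tau> < st \<eta> v (Suc j)"
  shows "i = j"
proof -
  have "st \<eta> v i < st \<eta> v (Suc j)" "st \<eta> v j < st \<eta> v (Suc i)"
    using assms by linarith+
  then show ?thesis by (simp add: st_less_iff)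
qed

lemma state_at_eq:
  assumes "st \<eta> v i \<le> \<tau>" "\<tau> < st \<eta> v (Suc i)"
  shows "state_at (X \<eta>) v \<tau> = sta \<eta> v i"
proof -
  have "(THE i. st \<eta> v i \<le> \<tau> \<and> \<tau> < st \<eta> v (Suc i)) = i"
    using assms round_unique by (intro the_equality) auto
  then show ?thesis by (simp add: state_at_def)
qed

text \<open>Nonempty intervals meet iff each begins before the other ends; the half-open end of the
  song makes the last comparison strict.\<close>

lemma reaches_iff:
  "reaches delay (X \<eta>) u j v i \<longleftrightarrow>
     st \<eta> u j < st \<eta> v (Suc i) \<and> st \<eta> u j + delay u v (st \<eta> u j) \<le> st \<eta> v (Suc i) \<and>
     st \<eta> v i < st \<eta> u (Suc j) + delay u v (st \<eta> u j)"
proof -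
  have *: "{a..<b} \<inter> {c..d} \<noteq> {} \<longleftrightarrow> a \<le> d \<and> c < b" if "a < b" "c < d" for a b c d :: real
  proof
    assume "a \<le> d \<and> c < b"
    with that have "max a c \<in> {a..<b} \<inter> {c..d}" by auto
    then show "{a..<b} \<inter> {c..d} \<noteq> {}" by blast
  qed auto
  have "st \<eta> u j < st \<eta> u (Suc j)" "st \<eta> v i < st \<eta> v (Suc i)"
    by (auto simp: st_less_iff)
  then show ?thesis
    unfolding reaches_def Let_def by (subst *) auto
qed

lemma heard_iff:
  "n \<in> hrd \<eta> v i \<longleftrightarrow>
     (\<exists>u j. {u, v} \<in> E \<and> reaches delay (X \<eta>) u j v i \<and> n \<in> notes_sung (sta \<eta> u j) (\<eta> (u, j)))"
  unfolding heard_def by blast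

lemma zero_in_notes_iff: "0 \<in> notes_sung s l \<longleftrightarrow> s = In"
  by (cases s) auto

text \<open>Start times grow by at least \<open>Tmin\<close> per round in every run, so the bound is
  uniform in \<open>\<eta>\<close>. This later confines the randomness to finitely many
  coordinates.\<close>

lemma ex_round_bound: "\<exists>N. \<forall>\<eta> v i. st \<eta> v i \<le> \<tau> \<longrightarrow> i < N"
proof -
  obtain N :: nat where "Max (range (\<lambda>v. (\<tau> - t0 v) / Tmin)) < real N"
    using reals_Archimedean2 by blast
  then have N: "(\<tau> - t0 v) / Tmin < real N" for v
    by (subst (asm) Max_less_iff) auto
  have "i < N" if "st \<eta> v i \<le> \<tau>" for \<eta> v i
  proof -
    have "t0 v + real i * Tmin \<le> \<tau>"
      using that st_add_ge[of \<eta> v 0 i] by (simp add: st_0)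
    then have "real i \<le> (\<tau> - t0 v) / Tmin"
      using Tmin_pos by (simp add: field_simps)
    with N[of v] show ?thesis by linarith
  qed
  then show ?thesis by blast
qed

lemma finite_rounds_before: "finite {(v, i). st \<eta> v i < \<tau>}"
proof -
  obtain N where "\<forall>\<eta> v i. st \<eta> v i \<le> \<tau> \<longrightarrow> i < N" using ex_round_bound by blast
  then have "{(v, i). st \<eta> v i < \<tau>} \<subseteq> UNIV \<times> {..<N}" by (auto dest: less_imp_le)
  then show ?thesis by (rule finite_subset) auto
qed

text \<open>Induction on start times is well-founded because only finitely many rounds begin before
  a given one.\<close>

lemma time_induct [case_names earlier]:
  assumes "\<And>v i. (\<And>u j. st \<eta> u j < st \<eta> v i \<Longrightarrow> P u j) \<Longrightarrow> P v i"
  shows "P v i"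
proof (induction "card {(u, j). st \<eta> u j < st \<eta> v i}" arbitrary: v i rule: less_induct)
  case less
  show ?case
  proof (rule assms)
    fix u j assume "st \<eta> u j < st \<eta> v i"
    then have "{(w, k). st \<eta> w k < st \<eta> u j} \<subset> {(w, k). st \<eta> w k < st \<eta> v i}"
      by auto
    from psubset_card_mono[OF finite_rounds_before this] less show "P u j" by blast
  qed
qed

text \<open>The history is part of the condition because it determines when the round ends.\<close>

definition same_round :: "('v \<times> nat \<Rightarrow> nat) \<Rightarrow> ('v \<times> nat \<Rightarrow> nat) \<Rightarrow> 'v \<Rightarrow> nat \<Rightarrow> bool" where
  "same_round \<eta> \<eta>' v i \<longleftrightarrow>
     st \<eta>' v i = st \<eta> v i \<and> sta \<eta>' v i = sta \<eta> v i \<and> hist \<eta>' v i = hist \<eta> v i"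

lemma same_round_end: "same_round \<eta> \<eta>' v i \<Longrightarrow> st \<eta>' v (Suc i) = st \<eta> v (Suc i)"
  by (simp add: same_round_def st_Suc)

lemma hist_Suc: "hist \<eta> v (Suc i) = hist \<eta> v i @ [(sta \<eta> v i, \<eta> (v, i), hrd \<eta> v i)]"
  by (simp add: local_history_def)

text \<open>Excludes extra early rounds in the run of \<open>\<eta>'\<close>: following one agent
  round by round, the first such round would contradict the assumption.\<close>

lemma started_before_transfer:
  assumes "\<And>i. st \<eta> v i < \<tau> \<Longrightarrow> st \<eta>' v (Suc i) < \<tau> \<Longrightarrow> st \<eta> v (Suc i) < \<tau>"
    and "st \<eta>' v j < \<tau>"
  shows "st \<eta> v j < \<tau>"
  using assms(2)
proof (induction j)
  case (Suc j)
  have "st \<eta>' v j < st \<eta>' v (Suc j)" by (simp add: st_less_iff)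
  with Suc assms(1)[of j] show ?case by simp
qed (simp add: st_0)

text \<open>A round's outcome depends only on songs begun strictly before its end, so induction on
  start times applies. The value of a round starting at \<open>\<tau>\<close> itself may
  differ.\<close>

lemma causality:
  assumes "\<And>v i. st \<eta> v i < \<tau> \<Longrightarrow> \<eta>' (v, i) = \<eta> (v, i)"
    and "st \<eta> v i \<le> \<tau>"
  shows "same_round \<eta> \<eta>' v i"
  using assms(2)
proof (induction v i rule: time_induct[where \<eta> = \<eta>])
  case (earlier v i)
  show ?case
  proof (cases i)
    case 0
    then show ?thesis by (simp add: same_round_def st_0 sta_0 local_history_def)
  next
    case (Suc k)
    have lt: "st \<eta> v k < st \<eta> v i" by (simp add: Suc st_less_iff)
    have prev: "same_round \<eta> \<eta>' v k"
      using earlier lt by simp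
    have IH: "same_round \<eta> \<eta>' u j" if "st \<eta> u j < st \<eta> v i" for u j
      using earlier that by simp
    have ends: "st \<eta>' v i = st \<eta> v i" and begins: "st \<eta>' v k = st \<eta> v k"
      using same_round_end[OF prev] prev by (auto simp: Suc same_round_def)
    \<comment> \<open>The second run has no additional songs that could reach \<open>v\<close> in
      round \<open>k\<close>.\<close>
    have before: "st \<eta> u j < st \<eta> v i" if "st \<eta>' u j < st \<eta> v i" for u j
      using same_round_end[OF IH] that by (intro started_before_transfer[of \<eta> u _ \<eta>' j]) auto
    have "n \<in> hrd \<eta>' v k \<longleftrightarrow> n \<in> hrd \<eta> v k" for n
    proof -
      have "reaches delay (X \<eta>') u j v k \<and> n \<in> notes_sung (sta \<eta>' u j) (\<eta>' (u, j)) \<longleftrightarrow>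
            reaches delay (X \<eta>) u j v k \<and> n \<in> notes_sung (sta \<eta> u j) (\<eta> (u, j))" for u j
      proof (cases "st \<eta> u j < st \<eta> v i")
        case True
        then have eq: "\<eta>' (u, j) = \<eta> (u, j)" using assms(1) earlier(2) by simp
        have "st \<eta>' u j = st \<eta> u j" "sta \<eta>' u j = sta \<eta> u j"
            "st \<eta>' u (Suc j) = st \<eta> u (Suc j)"
          using IH[OF True] same_round_end[OF IH[OF True]] by (auto simp: same_round_def)
        with eq show ?thesis
          unfolding reaches_iff ends[unfolded Suc] begins by simp
      next
        case False
        with before[of u j] show ?thesis
          unfolding reaches_iff ends[unfolded Suc] unfolding Suc by blast
      qed
      then show ?thesis unfolding heard_iff by blast
    qed
    then have "hrd \<eta>' v k = hrd \<eta> v k" by blast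
    moreover have "\<eta>' (v, k) = \<eta> (v, k)" using assms(1) earlier(2) lt by simp
    ultimately show ?thesis
      using prev ends by (simp add: same_round_def Suc sta_Suc hist_Suc)
  qed
qed

lemma causality_started:
  assumes agree: "\<And>v i. st \<eta> v i < \<tau> \<Longrightarrow> \<eta>' (v, i) = \<eta> (v, i)"
  shows "st \<eta>' v i \<le> \<tau> \<longleftrightarrow> st \<eta> v i \<le> \<tau>"
proof
  assume "st \<eta> v i \<le> \<tau>"
  with causality[of \<eta> \<tau> \<eta>', OF agree this] show "st \<eta>' v i \<le> \<tau>" by (simp add: same_round_def)
next
  assume "st \<eta>' v i \<le> \<tau>"
  then show "st \<eta> v i \<le> \<tau>"
  proof (induction i)
    case (Suc k)
    have "st \<eta>' v k < st \<eta>' v (Suc k)" by (simp add: st_less_iff)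
    with Suc have "st \<eta> v k \<le> \<tau>" by simp
    from same_round_end[OF causality[of \<eta> \<tau> \<eta>', OF agree this]] show ?case
      using Suc by simp
  qed (simp add: st_0)
qed

section \<open>The set of \<open>In\<close> agents\<close>

lemma edge_sym: "{u, v} \<in> E \<longleftrightarrow> {v, u} \<in> E"
  by (simp add: insert_commute)

text \<open>At the common time \<open>\<tau>\<close> the song is being sung, and it began to arrive
  by \<open>\<tau> + \<Delta>max\<close>, within the listening round.\<close>

lemma reaches_if_overlap:
  assumes "{u, v} \<in> E" "st \<eta> u j \<le> \<tau>" "\<tau> < st \<eta> u (Suc j)"
    and "st \<eta> v i \<le> \<tau>" "\<tau> < st \<eta> v (Suc i)" "\<tau> + \<Delta>max \<le> st \<eta> v (Suc i)"
  shows "reaches delay (X \<eta>) u j v i"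
  using delays[OF assms(1), of "st \<eta> u j"] assms unfolding reaches_iff by linarith

text \<open>The song begins at least \<open>Tmin\<close> before it ends, hence arrives by
  \<open>st \<eta> v (Suc i) + 2 * \<Delta>max - Tmin\<close>. In the extreme case this is exactly
  the closed right end of the listening round.\<close>

lemma reaches_if_ends_close:
  assumes "{u, v} \<in> E" "st \<eta> u (Suc j) \<le> st \<eta> v (Suc i) + \<Delta>max"
    and "st \<eta> v (Suc i) \<le> st \<eta> u (Suc j) + \<Delta>max"
  shows "reaches delay (X \<eta>) u j v i"
  using delays[OF assms(1), of "st \<eta> u j"] assms st_Suc_ge[of \<eta> u j] st_Suc_ge[of \<eta> v i]
    delay_bound delay_bound_nonneg Tmin_pos
  unfolding reaches_iff by linarith

lemma hears_zero:
  assumes "{u, v} \<in> E" "reaches delay (X \<eta>) u j v i" "sta \<eta> u j = In"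
  shows "0 \<in> hrd \<eta> v i"
  using assms unfolding heard_iff by force

lemma hears_zeroE:
  assumes "0 \<in> hrd \<eta> v i"
  obtains u j where "{u, v} \<in> E" "reaches delay (X \<eta>) u j v i" "sta \<eta> u j = In"
  using assms unfolding heard_iff zero_in_notes_iff by blast

lemma hears_note:
  assumes "{u, v} \<in> E" "reaches delay (X \<eta>) u j v i" "sta \<eta> u j = Undecided" "n \<in> {1..\<eta> (u, j)}"
  shows "n \<in> hrd \<eta> v i"
  using assms unfolding heard_iff by force

lemma becomes_InD:
  assumes "sta \<eta> v (Suc i) = In"
  shows "0 \<notin> hrd \<eta> v i"
    and "sta \<eta> v i = In \<or> sta \<eta> v i = Undecided \<and> \<eta> (v, i) \<notin> hrd \<eta> v i"
  using assms unfolding sta_Suc by (cases "sta \<eta> v i"; simp split: if_splits)+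

lemma becomes_OutD:
  assumes "sta \<eta> v (Suc i) = Out"
  shows "0 \<in> hrd \<eta> v i"
  using assms unfolding sta_Suc by (cases "sta \<eta> v i"; simp split: if_splits)+

lemma Undecided_wins:
  assumes "sta \<eta> v i = Undecided" "0 \<notin> hrd \<eta> v i" "\<eta> (v, i) \<notin> hrd \<eta> v i"
  shows "sta \<eta> v (Suc i) = In"
  using assms unfolding sta_Suc by simp

text \<open>Induction on the later of the two rounds. If \<open>u\<close> was \<open>In\<close>
  early enough, \<open>v\<close> heard note 0 before that round. Otherwise the preceding rounds end
  within \<open>\<Delta>max\<close> of each other, so both agents hear each other and each
  \<open>\<ell>\<close>-value would have to exceed the other.\<close>

lemma no_adjacent_In_aux:
  assumes ge1: "\<forall>r. 1 \<le> \<eta> r"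
  shows "\<forall>u j. {u, v} \<in> E \<longrightarrow> st \<eta> u j \<le> st \<eta> v i \<longrightarrow> sta \<eta> u j = In \<longrightarrow> sta \<eta> v i \<noteq> In"
proof (induction v i rule: time_induct[where \<eta> = \<eta>])
  case (earlier v i)
  have IH: False
    if "{a, b} \<in> E" "st \<eta> a k < st \<eta> v i" "st \<eta> b l < st \<eta> v i" "sta \<eta> a k = In" "sta \<eta> b l = In"
    for a b k l
  proof (cases "st \<eta> a k \<le> st \<eta> b l")
    case True
    with earlier[of b l] that show False by blast
  next
    case False
    then have "st \<eta> b l \<le> st \<eta> a k" by simp
    with earlier[of a k] that edge_sym show False by blast
  qed
  show ?case
  proof (intro allI impI notI)
    fix u j
    assume uv: "{u, v} \<in> E" and le: "st \<eta> u j \<le> st \<eta> v i"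
      and uIn: "sta \<eta> u j = In" and vIn: "sta \<eta> v i = In"
    obtain i' where i: "i = Suc i'" using vIn sta_0 by (cases i) auto
    obtain j' where j: "j = Suc j'" using uIn sta_0 by (cases j) auto
    have i': "st \<eta> v i' + Tmin \<le> st \<eta> v i" and j': "st \<eta> u j' + Tmin \<le> st \<eta> u j"
      using st_Suc_ge by (auto simp: i j)
    have v0: "0 \<notin> hrd \<eta> v i'" using becomes_InD vIn i by simp
    have u0: "0 \<notin> hrd \<eta> u j'" using becomes_InD uIn j by simp
    show False
    proof (cases "st \<eta> u j + \<Delta>max \<le> st \<eta> v i \<and> st \<eta> u j < st \<eta> v i")
      case True
      \<comment> \<open>A moment after \<open>u\<close> became \<open>In\<close> from which songs
        still reach \<open>v\<close> in time, as \<open>\<Delta>max \<le> Tmin / 2\<close>.\<close>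
      define \<tau> where "\<tau> = max (st \<eta> u j) (st \<eta> v i - Tmin / 2)"
      have \<tau>: "\<tau> < st \<eta> v i" "\<tau> + \<Delta>max \<le> st \<eta> v i" "st \<eta> v i' \<le> \<tau>" "st \<eta> u j \<le> \<tau>"
        using True i' Tmin_pos delay_bound by (auto simp: \<tau>_def)
      obtain k where k: "j \<le> k" "st \<eta> u k \<le> \<tau>" "\<tau> < st \<eta> u (Suc k)"
        using ex_round \<tau>(4) by blast
      have "sta \<eta> u m = In" if "j \<le> m" "st \<eta> u m \<le> \<tau>" for m
        using that
      proof (induction m rule: dec_induct)
        case (step m)
        have m: "st \<eta> u m < st \<eta> u (Suc m)" by (simp add: st_less_iff)
        then have In: "sta \<eta> u m = In" using step by simp
        have "0 \<notin> hrd \<eta> u m"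
        proof
          assume "0 \<in> hrd \<eta> u m"
          then obtain w l where w: "{w, u} \<in> E" "reaches delay (X \<eta>) w l u m" "sta \<eta> w l = In"
            by (rule hears_zeroE)
          then have "st \<eta> w l < st \<eta> u (Suc m)" by (simp add: reaches_iff)
          then have "st \<eta> w l < st \<eta> v i" "st \<eta> u m < st \<eta> v i"
            using step.prems \<tau>(1) m by linarith+
          with IH[of w u l m] w In show False by blast
        qed
        with In show ?case by (simp add: sta_Suc)
      qed (use uIn in simp)
      then have "sta \<eta> u k = In" using k by simp
      moreover have "reaches delay (X \<eta>) u k v i'"
        using reaches_if_overlap[OF uv k(2,3)] \<tau> i by simp
      ultimately show False using hears_zero uv v0 by blast
    next
      case False
      then have late: "st \<eta> v i \<le> st \<eta> u j + \<Delta>max" using le delay_bound_nonneg by linarith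
      have le': "st \<eta> u j \<le> st \<eta> v i + \<Delta>max" using le delay_bound_nonneg by linarith
      have r1: "reaches delay (X \<eta>) u j' v i'"
        using reaches_if_ends_close[OF uv, of \<eta> j' i'] late le' i j by simp
      have r2: "reaches delay (X \<eta>) v i' u j'"
        using reaches_if_ends_close[of v u \<eta> i' j'] uv edge_sym late le' i j by simp
      have "sta \<eta> u j' \<noteq> In" using hears_zero[OF uv r1] v0 by blast
      then have u1: "sta \<eta> u j' = Undecided" "\<eta> (u, j') \<notin> hrd \<eta> u j'"
        using becomes_InD(2)[of \<eta> u j'] uIn j by auto
      have "sta \<eta> v i' \<noteq> In" using hears_zero[OF _ r2] u0 uv edge_sym by blast
      then have v1: "sta \<eta> v i' = Undecided" "\<eta> (v, i') \<notin> hrd \<eta> v i'"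
        using becomes_InD(2)[of \<eta> v i'] vIn i by auto
      have "\<eta> (v, i') > \<eta> (u, j')"
        \<comment> \<open>An \<open>Undecided\<close> agent sings all notes from 1 to its
          \<open>\<ell>\<close>-value, so an unheard positive note lies above that value.\<close>
        using hears_note[OF uv r1 u1(1), of "\<eta> (v, i')"] v1(2) ge1[rule_format, of "(v, i')"] by force
      moreover have "\<eta> (u, j') > \<eta> (v, i')"
        using hears_note[OF _ r2 v1(1), of "\<eta> (u, j')"] u1(2) ge1[rule_format, of "(u, j')"] uv edge_sym by force
      ultimately show False by simp
    qed
  qed
qed

lemma no_adjacent_In:
  assumes "\<forall>r. 1 \<le> \<eta> r" "{u, v} \<in> E" "sta \<eta> u j = In"
  shows "sta \<eta> v i \<noteq> In"
proof (cases "st \<eta> u j \<le> st \<eta> v i")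
  case True
  with no_adjacent_In_aux[OF assms(1), where v = v and i = i] assms show ?thesis by blast
next
  case False
  then have "st \<eta> v i \<le> st \<eta> u j" by simp
  with no_adjacent_In_aux[OF assms(1), where v = u and i = j] assms edge_sym show ?thesis by blast
qed

lemma In_forever:
  assumes "\<forall>r. 1 \<le> \<eta> r" "sta \<eta> v i = In" "i \<le> j"
  shows "sta \<eta> v j = In"
  using assms(3)
proof (induction j rule: dec_induct)
  case (step m)
  have "0 \<notin> hrd \<eta> v m"
    using no_adjacent_In[OF assms(1)] step.IH by (blast elim: hears_zeroE)
  with step.IH show ?case by (simp add: sta_Suc)
qed (use assms in simp)

text \<open>
  Since \<open>In\<close> agents stay \<open>In\<close> and never have an \<open>In\<close> neighbour, elimination amounts to an agent or one of
  its neighbours having ever become \<open>In\<close>.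
\<close>

definition has_joined :: "('v \<times> nat \<Rightarrow> nat) \<Rightarrow> 'v \<Rightarrow> real \<Rightarrow> bool" where
  "has_joined \<eta> v \<tau> \<longleftrightarrow> (\<exists>i. sta \<eta> v i = In \<and> st \<eta> v i \<le> \<tau>)"

lemma has_joined_mono: "has_joined \<eta> v \<tau> \<Longrightarrow> \<tau> \<le> \<tau>' \<Longrightarrow> has_joined \<eta> v \<tau>'"
  unfolding has_joined_def by force

lemma no_adjacent_joined:
  assumes "\<forall>r. 1 \<le> \<eta> r" "{u, v} \<in> E" "has_joined \<eta> u \<tau>"
  shows "sta \<eta> v i \<noteq> In" "\<not> has_joined \<eta> v \<tau>'"
  using assms no_adjacent_In unfolding has_joined_def by blast+

lemma has_joined_In:
  assumes "\<forall>r. 1 \<le> \<eta> r" "has_joined \<eta> v \<tau>" "\<tau> < st \<eta> v (Suc i)"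
  shows "sta \<eta> v i = In"
proof -
  obtain k where k: "sta \<eta> v k = In" "st \<eta> v k \<le> \<tau>"
    using assms(2) unfolding has_joined_def by blast
  then have "st \<eta> v k < st \<eta> v (Suc i)" using assms(3) by linarith
  then have "k \<le> i" by (simp add: st_less_iff)
  with In_forever[OF assms(1)] k show ?thesis by blast
qed

lemma Out_has_joined_neighbour:
  assumes "sta \<eta> v i = Out"
  shows "\<exists>u. {u, v} \<in> E \<and> has_joined \<eta> u (st \<eta> v i)"
proof (cases i)
  case 0
  with assms show ?thesis by (simp add: sta_0)
next
  case (Suc k)
  with becomes_OutD assms have "0 \<in> hrd \<eta> v k" by blast
  then obtain u j where "{u, v} \<in> E" "reaches delay (X \<eta>) u j v k" "sta \<eta> u j = In"
    by (rule hears_zeroE)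
  then show ?thesis using Suc by (force simp: reaches_iff has_joined_def)
qed

lemma state_at_In_iff:
  assumes "\<forall>r. 1 \<le> \<eta> r" "t0 v \<le> \<tau>"
  shows "state_at (X \<eta>) v \<tau> = In \<longleftrightarrow> has_joined \<eta> v \<tau>"
proof -
  obtain i where i: "st \<eta> v i \<le> \<tau>" "\<tau> < st \<eta> v (Suc i)"
    using ex_round[of \<eta> v 0 \<tau>] assms(2) st_0 by auto
  show ?thesis
    using state_at_eq[OF i] has_joined_In[OF assms(1) _ i(2)] i unfolding has_joined_def by auto
qed

definition out_of_play :: "('v \<times> nat \<Rightarrow> nat) \<Rightarrow> 'v \<Rightarrow> real \<Rightarrow> bool" where
  "out_of_play \<eta> v \<tau> \<longleftrightarrow> has_joined \<eta> v \<tau> \<or> (\<exists>u. {u, v} \<in> E \<and> has_joined \<eta> u \<tau>)"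

lemma out_of_play_mono: "out_of_play \<eta> v \<tau> \<Longrightarrow> \<tau> \<le> \<tau>' \<Longrightarrow> out_of_play \<eta> v \<tau>'"
  unfolding out_of_play_def using has_joined_mono by blast

lemma eliminated_iff:
  assumes "\<forall>r. 1 \<le> \<eta> r" "\<And>v. t0 v \<le> \<tau>"
  shows "eliminated E (X \<eta>) v \<tau> \<longleftrightarrow> out_of_play \<eta> v \<tau>"
proof -
  have "lone_In E (X \<eta>) v \<tau> \<longleftrightarrow> has_joined \<eta> v \<tau>" for v
    using state_at_In_iff[OF assms] no_adjacent_joined(2)[OF assms(1)]
    unfolding lone_In_def by blast
  then show ?thesis unfolding eliminated_def out_of_play_def by simp
qed

text \<open>From \<open>\<tau>\<close> on \<open>x\<close> sings note 0, which reaches round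
  \<open>k\<close> of \<open>w\<close> before it ends; \<open>w\<close> itself is never
  \<open>In\<close>, so it turns or stays \<open>Out\<close>.\<close>

lemma Out_after_neighbour_joined:
  assumes ge1: "\<forall>r. 1 \<le> \<eta> r" and "{x, w} \<in> E" "has_joined \<eta> x \<tau>"
    and "\<tau> + \<Delta>max < st \<eta> w (Suc k)"
  shows "sta \<eta> w (Suc k) = Out"
proof -
  define \<sigma> where "\<sigma> = max \<tau> (st \<eta> w (Suc k) - Tmin / 2)"
  have \<sigma>: "\<tau> \<le> \<sigma>" "st \<eta> w k \<le> \<sigma>" "\<sigma> < st \<eta> w (Suc k)" "\<sigma> + \<Delta>max \<le> st \<eta> w (Suc k)"
    using st_Suc_ge[of \<eta> w k] assms(4) delay_bound delay_bound_nonneg Tmin_pos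
    by (auto simp: \<sigma>_def)
  obtain i where i: "sta \<eta> x i = In" "st \<eta> x i \<le> \<tau>"
    using assms(3) unfolding has_joined_def by blast
  then obtain j where j: "i \<le> j" "st \<eta> x j \<le> \<sigma>" "\<sigma> < st \<eta> x (Suc j)"
    using ex_round[of \<eta> x i \<sigma>] \<sigma>(1) by auto
  have "reaches delay (X \<eta>) x j w k"
    using reaches_if_overlap[OF assms(2) j(2,3)] \<sigma> by blast
  then have "0 \<in> hrd \<eta> w k"
    using hears_zero assms(2) In_forever[OF ge1 i(1) j(1)] by blast
  moreover have "sta \<eta> w k \<noteq> In"
    using no_adjacent_joined[OF ge1 assms(2,3)] by blast
  ultimately show ?thesis unfolding sta_Suc by (cases "sta \<eta> w k") auto
qed

section \<open>Loud rounds\<close>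

lemma causality_out_of_play:
  assumes "\<And>v i. st \<eta> v i < \<tau> \<Longrightarrow> \<eta>' (v, i) = \<eta> (v, i)"
  shows "has_joined \<eta>' v \<tau> \<longleftrightarrow> has_joined \<eta> v \<tau>"
    and "out_of_play \<eta>' v \<tau> \<longleftrightarrow> out_of_play \<eta> v \<tau>"
proof -
  show *: "has_joined \<eta>' v \<tau> \<longleftrightarrow> has_joined \<eta> v \<tau>" for v
    using causality[of \<eta> \<tau> \<eta>', OF assms] causality_started[of \<eta> \<tau> \<eta>', OF assms]
    unfolding has_joined_def same_round_def by metis
  show "out_of_play \<eta>' v \<tau> \<longleftrightarrow> out_of_play \<eta> v \<tau>"
    unfolding out_of_play_def * ..
qed

text \<open>By \<open>quiet\<close>, \<open>u\<close> is not \<open>Out\<close> when the round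
  begins. Note 0 could only come from a neighbour that joined after \<open>u\<close>'s song had
  reached it, hence with a larger \<open>\<ell>\<close>-value. A neighbour singing
  \<open>u\<close>'s own note is either a beaten competitor or was out of play at \<open>t\<close>
  and is \<open>Out\<close> by now.\<close>

lemma loud_round_joins:
  assumes ge1: "\<forall>r. 1 \<le> \<eta> r" and started: "\<And>v. t0 v \<le> t"
    and active: "\<not> out_of_play \<eta> u t"
    and late: "t + 2 * \<Delta>max + Tmax < st \<eta> u i"
    and loudest: "\<And>w k. {w, u} \<in> E \<Longrightarrow> \<not> out_of_play \<eta> w t \<Longrightarrow> t < st \<eta> w k \<Longrightarrow>
      st \<eta> w k < st \<eta> u (Suc i) \<Longrightarrow> \<eta> (w, k) < \<eta> (u, i)"
    and quiet: "\<And>w. {w, u} \<in> E \<Longrightarrow> \<not> has_joined \<eta> w (st \<eta> u i + \<Delta>max)"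
  shows "has_joined \<eta> u (st \<eta> u (Suc i))"
proof (cases "sta \<eta> u i = In")
  case True
  with In_forever[OF ge1 True, of "Suc i"] show ?thesis unfolding has_joined_def by auto
next
  case False
  have "sta \<eta> u i \<noteq> Out"
    using Out_has_joined_neighbour[of \<eta> u i] quiet
      has_joined_mono[of \<eta> _ "st \<eta> u i" "st \<eta> u i + \<Delta>max"] delay_bound_nonneg by auto
  with False have un: "sta \<eta> u i = Undecided" by (cases "sta \<eta> u i") auto
  have nbr: "\<not> has_joined \<eta> w t" if "{w, u} \<in> E" for w
    using active that unfolding out_of_play_def by blast
  have "0 \<notin> hrd \<eta> u i"
  proof
    assume "0 \<in> hrd \<eta> u i"
    then obtain w k0 where w: "{w, u} \<in> E" "reaches delay (X \<eta>) w k0 u i" "sta \<eta> w k0 = In"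
      by (rule hears_zeroE)
    \<comment> \<open>The round \<open>k'\<close> before the first \<open>In\<close> round is the
      one in which \<open>w\<close> decided to join.\<close>
    define k where "k = (LEAST k. sta \<eta> w k = In)"
    have k: "sta \<eta> w k = In" "k \<le> k0"
      unfolding k_def using w(3) by (auto intro: LeastI Least_le)
    then obtain k' where k': "k = Suc k'" using sta_0 by (cases k) auto
    then have "sta \<eta> w k' \<noteq> In" using not_less_Least[of k' "\<lambda>k. sta \<eta> w k = In"] k_def by auto
    with becomes_InD(2)[of \<eta> w k'] k k' have wk': "sta \<eta> w k' = Undecided" "\<eta> (w, k') \<notin> hrd \<eta> w k'"
      by auto
    have "st \<eta> w k \<le> st \<eta> w k0" using k by (simp add: st_le_iff)
    then have ends: "st \<eta> w k < st \<eta> u (Suc i)" using w(2) by (simp add: reaches_iff)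
    have begins: "st \<eta> u i + \<Delta>max < st \<eta> w k"
      using quiet[OF w(1)] k(1) unfolding has_joined_def by (auto simp: not_le)
    have dl: "0 \<le> delay u w (st \<eta> u i)" "delay u w (st \<eta> u i) \<le> \<Delta>max"
      using delays[of u w] w(1) edge_sym by auto
    have bk: "st \<eta> w k' < st \<eta> w k" "st \<eta> w k \<le> st \<eta> w k' + Tmax"
      using st_Suc_le k' by (auto simp: st_less_iff)
    have "reaches delay (X \<eta>) u i w k'"
      unfolding reaches_iff using k' dl begins ends bk(1) delay_bound_nonneg by auto
    then have "\<eta> (u, i) < \<eta> (w, k')"
      using hears_note[of u w \<eta> i k' "\<eta> (w, k')"] un wk'(2) w(1) edge_sym ge1 by force
    moreover have "\<not> out_of_play \<eta> w t"
      using nbr[OF w(1)] no_adjacent_joined(1)[OF ge1, of _ w] k(1) unfolding out_of_play_def by blast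
    then have "\<eta> (w, k') < \<eta> (u, i)"
      using loudest[OF w(1), of k'] begins late ends bk delay_bound_nonneg by simp
    ultimately show False by simp
  qed
  moreover have "\<eta> (u, i) \<notin> hrd \<eta> u i"
  proof
    assume "\<eta> (u, i) \<in> hrd \<eta> u i"
    then obtain w k where w: "{w, u} \<in> E" and r: "reaches delay (X \<eta>) w k u i"
      and n: "\<eta> (u, i) \<in> notes_sung (sta \<eta> w k) (\<eta> (w, k))"
      unfolding heard_iff by blast
    have pos: "0 < \<eta> (u, i)" using ge1[rule_format, of "(u, i)"] by simp
    with n have wk: "sta \<eta> w k = Undecided" "\<eta> (u, i) \<le> \<eta> (w, k)"
      by (cases "sta \<eta> w k"; simp)+
    have "st \<eta> u i < st \<eta> w (Suc k) + \<Delta>max"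
      using r delays[OF w, of "st \<eta> w k"] unfolding reaches_iff by linarith
    \<comment> \<open>The offset \<open>2 * \<Delta>max + Tmax\<close> pays for the delay of this
      song, for its duration and for the delay of the note 0 that silences \<open>w\<close>.\<close>
    then have fresh: "t + \<Delta>max < st \<eta> w k" using late st_Suc_le[of \<eta> w k] by linarith
    show False
    proof (cases "out_of_play \<eta> w t")
      case True
      then obtain x where x: "{x, w} \<in> E" "has_joined \<eta> x t"
        using nbr[OF w] unfolding out_of_play_def by blast
      obtain k' where "k = Suc k'"
        using fresh started[of w] delay_bound_nonneg by (cases k) (auto simp: st_0)
      with Out_after_neighbour_joined[OF ge1 x, of k'] fresh wk show False by simp
    next
      case False
      have "st \<eta> w k < st \<eta> u (Suc i)" using r by (simp add: reaches_iff)
      with loudest[OF w False] fresh delay_bound_nonneg wk show False by force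
    qed
  qed
  ultimately have "sta \<eta> u (Suc i) = In" using un Undecided_wins by blast
  then show ?thesis unfolding has_joined_def by blast
qed

text \<open>
  A louder song in round \<open>(u, i)\<close> can keep a neighbour of \<open>u\<close> from joining, and only through such a
  neighbour can it change anything before time \<open>st \<eta> u i + \<Delta>max\<close>: every other change
  would need another complete round.
\<close>

lemma louder_round_quiet:
  assumes louder: "\<eta> (u, i) \<le> m" and \<eta>': "\<eta>' = \<eta>((u, i) := m)"
    and quiet: "\<And>w. {w, u} \<in> E \<Longrightarrow> \<not> has_joined \<eta> w (st \<eta> u i + \<Delta>max)"
    and wu: "{w, u} \<in> E"
  shows "\<not> has_joined \<eta>' w (st \<eta> u i + \<Delta>max)"
proof -
  define \<sigma> where "\<sigma> = st \<eta> u i"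
  have agree: "\<eta>' (v, k) = \<eta> (v, k)" if "st \<eta> v k < \<sigma>" for v k
    using that by (auto simp: \<eta>' \<sigma>_def)
  have caus: "same_round \<eta> \<eta>' v k" if "st \<eta> v k \<le> \<sigma>" for v k
    using causality[of \<eta> \<sigma> \<eta>'] agree that by blast
  have lt: "\<Delta>max < Tmin" using delay_bound delay_bound_nonneg Tmin_pos by linarith
  \<comment> \<open>Start times and states are compared, but not the notes heard: these can differ
    at the neighbours of \<open>u\<close>.\<close>
  have same: "st \<eta>' v k = st \<eta> v k \<and> sta \<eta>' v k = sta \<eta> v k" if "st \<eta> v k \<le> \<sigma> + \<Delta>max" for v k
    using that
  proof (induction v k rule: time_induct[where \<eta> = \<eta>])
    case (earlier v k)
    show ?case
    proof (cases "st \<eta> v k \<le> \<sigma>")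
      case True
      from caus[OF this] show ?thesis by (simp add: same_round_def)
    next
      case False
      show ?thesis
      proof (cases k)
        case 0
        then show ?thesis by (simp add: st_0 sta_0)
      next
        case (Suc l)
        \<comment> \<open>As \<open>\<Delta>max < Tmin\<close>, a round ending by
          \<open>\<sigma> + \<Delta>max\<close> began before \<open>\<sigma>\<close>, where
          causality applies.\<close>
        have l: "st \<eta> v l < \<sigma>"
          using earlier.prems st_Suc_ge[of \<eta> v l] lt Suc by simp
        then have prev: "same_round \<eta> \<eta>' v l" by (intro caus) simp
        then have begins: "st \<eta>' v l = st \<eta> v l" and prev_state: "sta \<eta>' v l = sta \<eta> v l"
          by (auto simp: same_round_def)
        have ends: "st \<eta>' v (Suc l) = st \<eta> v (Suc l)"
          using same_round_end[OF prev] by simp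
        have IH: "st \<eta>' b j = st \<eta> b j \<and> sta \<eta>' b j = sta \<eta> b j" if "st \<eta> b j < st \<eta> v k" for b j
          using earlier.IH[of b j] that earlier.prems by simp
        \<comment> \<open>Rounds begun after \<open>\<sigma>\<close> may change their ends, but in
          both runs these fall beyond the horizon.\<close>
        have long: "\<sigma> + \<Delta>max < st \<eta>1 b (Suc j)" if "\<sigma> < st \<eta>1 b j" for \<eta>1 b j
          using st_Suc_ge[of \<eta>1 b j] that lt by linarith
        have before: "st \<eta> b j < st \<eta> v k" if "st \<eta>' b j < st \<eta> v k" for b j
        proof (rule started_before_transfer[of \<eta> b _ \<eta>' j])
          fix a assume a: "st \<eta> b a < st \<eta> v k" "st \<eta>' b (Suc a) < st \<eta> v k"
          have "st \<eta> b a \<le> \<sigma>"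
            using long[of \<eta>' b a] IH[OF a(1)] a(2) earlier.prems by force
          from same_round_end[OF caus[OF this]] show "st \<eta> b (Suc a) < st \<eta> v k"
            using a by simp
        qed fact
        have reach: "reaches delay (X \<eta>') b j v l \<longleftrightarrow> reaches delay (X \<eta>) b j v l"
          if "{b, v} \<in> E" for b j
        proof (cases "st \<eta> b j < st \<eta> v k")
          case True
          show ?thesis
          proof (cases "st \<eta> b j \<le> \<sigma>")
            case True
            from same_round_end[OF caus[OF this]] caus[OF this] show ?thesis
              unfolding reaches_iff ends begins by (simp add: same_round_def)
          next
            case False
            then have "\<sigma> + \<Delta>max < st \<eta> b (Suc j)" "\<sigma> + \<Delta>max < st \<eta>' b (Suc j)"
              using long[of \<eta> b j] long[of \<eta>' b j] IH[OF True] by auto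
            then show ?thesis
              using delays[OF that, of "st \<eta> b j"] l IH[OF True] delay_bound_nonneg
              unfolding reaches_iff ends begins by auto
          qed
        next
          case False
          with before[of b j] show ?thesis
            unfolding reaches_iff ends unfolding Suc by blast
        qed
        have old: "\<eta>' (v, l) = \<eta> (v, l)" using agree l by blast
        have more: "n \<in> hrd \<eta>' v l" if n: "n \<in> hrd \<eta> v l" for n
        proof -
          obtain b j where bj: "{b, v} \<in> E" "reaches delay (X \<eta>) b j v l"
            "n \<in> notes_sung (sta \<eta> b j) (\<eta> (b, j))"
            using n unfolding heard_iff by blast
          then have "sta \<eta>' b j = sta \<eta> b j" using IH[of b j] Suc by (simp add: reaches_iff)
          moreover have "\<eta> (b, j) \<le> \<eta>' (b, j)" using louder by (auto simp: \<eta>')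
          ultimately have "n \<in> notes_sung (sta \<eta>' b j) (\<eta>' (b, j))"
            using bj(3) by (cases "sta \<eta> b j") auto
          with bj reach show ?thesis unfolding heard_iff by blast
        qed
        have less: "n \<in> hrd \<eta> v l" if n: "n \<in> hrd \<eta>' v l" and *: "{u, v} \<notin> E \<or> n = 0" for n
        proof -
          obtain b j where bj: "{b, v} \<in> E" "reaches delay (X \<eta>') b j v l"
            "n \<in> notes_sung (sta \<eta>' b j) (\<eta>' (b, j))"
            using n unfolding heard_iff by blast
          then have r: "reaches delay (X \<eta>) b j v l" using reach by blast
          then have "sta \<eta>' b j = sta \<eta> b j" using IH[of b j] Suc by (simp add: reaches_iff)
          then have "n \<in> notes_sung (sta \<eta> b j) (\<eta> (b, j))"
            using bj * by (cases "sta \<eta> b j") (auto simp: \<eta>' split: if_splits)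
          with bj(1) r show ?thesis unfolding heard_iff by blast
        qed
        have "sta \<eta>' v (Suc l) = sta \<eta> v (Suc l)"
        proof (cases "{u, v} \<in> E")
          case False
          with more less have "hrd \<eta>' v l = hrd \<eta> v l" by blast
          then show ?thesis by (simp add: sta_Suc prev_state old)
        next
          case True
          \<comment> \<open>Since \<open>v\<close> does not join in the original run, additional
            positive notes cannot alter its next state.\<close>
          have "\<not> has_joined \<eta> v (\<sigma> + \<Delta>max)"
            using quiet True edge_sym unfolding \<sigma>_def by blast
          then have "sta \<eta> v l \<noteq> In" "sta \<eta> v (Suc l) \<noteq> In"
            using earlier.prems l delay_bound_nonneg Suc unfolding has_joined_def by force+
          then show ?thesis
            using more[of 0] less[of 0] more[of "\<eta> (v, l)"]
            by (cases "sta \<eta> v l") (auto simp: sta_Suc prev_state old split: if_splits)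
        qed
        with ends Suc show ?thesis by simp
      qed
    qed
  qed
  have "st \<eta> w k \<le> \<sigma> + \<Delta>max" if "st \<eta>' w k \<le> \<sigma> + \<Delta>max" for k
  proof (cases k)
    case 0
    with that show ?thesis by (simp add: st_0)
  next
    case (Suc l)
    have "st \<eta>' w l \<le> \<sigma>" using that st_Suc_ge[of \<eta>' w l] lt Suc by simp
    then have "st \<eta> w l \<le> \<sigma>" using causality_started[of \<eta> \<sigma> \<eta>'] agree by blast
    from same_round_end[OF caus[OF this]] that Suc show ?thesis by simp
  qed
  then show ?thesis
    using same[of w] quiet[OF wu] unfolding has_joined_def \<sigma>_def by metis
qed

end

section \<open>The expected number of active edges\<close>

text \<open>The past is frozen in \<open>\<omega>\<close>; an argument \<open>\<xi>\<close> supplies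
  the values of rounds that start after \<open>t\<close>.\<close>

locale singing_snapshot = singing_protocol E delay t0 dur X Tmin Tmax \<Delta>max
  for E :: "'v::finite set set" and delay t0 dur X Tmin Tmax \<Delta>max +
  fixes Tdiff t :: real and \<omega> :: "'v \<times> nat \<Rightarrow> nat"
  assumes Tdiff: "Tdiff = 2 * \<Delta>max + 3 * Tmax"
    and started: "\<And>v. t0 v \<le> 0"
    and time: "0 \<le> t"
    and history: "\<forall>r. 1 \<le> \<omega> r"
begin

abbreviation "\<rho> \<equiv> resample_after t (X \<omega>) \<omega>"
abbreviation "A \<equiv> active_edges E (X \<omega>) t"

lemma started_t: "t0 v \<le> t"
  using started[of v] time by linarith

lemma resample_ge_1: "\<forall>r. 1 \<le> \<xi> r \<Longrightarrow> \<forall>r. 1 \<le> \<rho> \<xi> r"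
  using history by (auto simp: resample_after_def)

lemma resample_past: "st \<omega> v i < t \<Longrightarrow> \<rho> \<xi> (v, i) = \<omega> (v, i)"
  by (simp add: resample_after_def)

lemma st_resample_le_iff: "st (\<rho> \<xi>) v i \<le> t \<longleftrightarrow> st \<omega> v i \<le> t"
  using causality_started[of \<omega> t "\<rho> \<xi>"] resample_past by blast

lemma st_resample_gt_iff: "t < st (\<rho> \<xi>) v i \<longleftrightarrow> t < st \<omega> v i"
  using st_resample_le_iff[of \<xi> v i] by linarith

lemma out_of_play_resample: "out_of_play (\<rho> \<xi>) v t \<longleftrightarrow> out_of_play \<omega> v t"
  using causality_out_of_play(2)[of \<omega> t "\<rho> \<xi>"] resample_past by blast

lemma resample_fresh:
  assumes "t < st \<omega> v i"
  shows "\<rho> \<xi> (v, i) = \<xi> (v, i)" "\<rho> (\<xi>((v, i) := m)) = (\<rho> \<xi>)((v, i) := m)"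
  using assms by (auto simp: resample_after_def fun_eq_iff)

lemma in_active_edges_iff:
  assumes "\<forall>r. 1 \<le> \<eta> r" "t \<le> \<tau>"
  shows "e \<in> active_edges E (X \<eta>) \<tau> \<longleftrightarrow> e \<in> E \<and> (\<forall>v\<in>e. \<not> out_of_play \<eta> v \<tau>)"
proof -
  have "t0 v \<le> \<tau>" for v using started_t[of v] assms(2) by linarith
  with eliminated_iff[OF assms(1)] show ?thesis by (simp add: active_edges_def)
qed

lemma nbrs_A_iff: "w \<in> nbrs A u \<longleftrightarrow> {w, u} \<in> E \<and> \<not> out_of_play \<omega> w t \<and> \<not> out_of_play \<omega> u t"
  using in_active_edges_iff[OF history, of t "{w, u}"] by (auto simp: nbrs_def)

lemma card_A: "e \<in> A \<Longrightarrow> card e = 2"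
  by (simp add: active_edges_def card_edge)

lemma Tdiff_ge: "2 * \<Delta>max + 3 * Tmin \<le> Tdiff"
  using Tdiff Tmin_le_Tmax by simp

lemma Tdiff_pos: "0 < Tdiff"
  using Tdiff_ge Tmin_pos delay_bound_nonneg by linarith

section \<open>Rivals and the special round\<close>

definition fresh :: "'v \<Rightarrow> nat" where
  "fresh w = (LEAST i. t < st \<omega> w i)"

definition R :: nat where
  "R = nat \<lceil>Tdiff / Tmin\<rceil>"

text \<open>Depends on \<open>\<omega>\<close> only: all runs \<open>\<rho> \<xi>\<close> agree on
  which rounds begin after \<open>t\<close>. Neighbours of \<open>v\<close> are included so that
  wins next to \<open>v\<close> exclude each other.\<close>

definition rivals :: "'v \<Rightarrow> 'v \<Rightarrow> ('v \<times> nat) set" where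
  "rivals u v = (SIGMA w:nbrs A u \<union> nbrs A v. {fresh w ..< fresh w + R})"

lemma fresh_round_bounds:
  assumes "t < st (\<rho> \<xi>) w i" "st (\<rho> \<xi>) w i < t + Tdiff"
  shows "i \<in> {fresh w ..< fresh w + R}"
proof -
  have gt: "t < st \<omega> w i" using assms(1) st_resample_gt_iff by blast
  have le: "fresh w \<le> i" unfolding fresh_def by (rule Least_le) (rule gt)
  have "t < st \<omega> w (fresh w)" unfolding fresh_def by (rule LeastI) (rule gt)
  then have "t < st (\<rho> \<xi>) w (fresh w)" using st_resample_gt_iff by blast
  with st_add_ge[of "\<rho> \<xi>" w "fresh w" "i - fresh w"] le assms(2)
  have "real (i - fresh w) * Tmin < Tdiff" by simp
  then have "real (i - fresh w) < Tdiff / Tmin" using Tmin_pos by (simp add: field_simps)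
  then have "i - fresh w < R" unfolding R_def by linarith
  with le show ?thesis by simp
qed

text \<open>
  When this round begins, songs of rounds begun before time \<open>t\<close> no longer reach \<open>u\<close>, nor do songs of
  neighbours that were eliminated at time \<open>t\<close>: these heard note 0 in a round ending by
  \<open>t + \<Delta>max + Tmax\<close>.  Yet the round is over by \<open>t + Tdiff\<close>.
\<close>

definition special :: "('v \<times> nat \<Rightarrow> nat) \<Rightarrow> 'v \<Rightarrow> nat" where
  "special \<xi> u = (LEAST i. t + 2 * \<Delta>max + Tmax < st (\<rho> \<xi>) u i)"

lemma special:
  shows "t + 2 * \<Delta>max + Tmax < st (\<rho> \<xi>) u (special \<xi> u)"
    and "\<forall>i<special \<xi> u. st (\<rho> \<xi>) u i \<le> t + 2 * \<Delta>max + Tmax"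
    and "st (\<rho> \<xi>) u (special \<xi> u) + \<Delta>max \<le> t + Tdiff"
    and "st (\<rho> \<xi>) u (Suc (special \<xi> u)) \<le> t + Tdiff"
    and "t < st \<omega> u (special \<xi> u)"
    and "st (\<rho> \<xi>) u (special \<xi> u) < t + Tdiff"
proof -
  let ?T = "t + 2 * \<Delta>max + Tmax" and ?s = "special \<xi> u"
  have T: "t0 u \<le> ?T" "t \<le> ?T" "\<Delta>max \<le> Tmax" "0 < Tmax"
    using started_t[of u] delay_bound_nonneg delay_bound Tmin_pos Tmin_le_Tmax by linarith+
  obtain i where "?T < st (\<rho> \<xi>) u (Suc i)"
    using ex_round[of "\<rho> \<xi>" u 0 ?T] T(1) st_0 by auto
  then show 1: "?T < st (\<rho> \<xi>) u ?s"
    unfolding special_def by (rule LeastI)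
  show 2: "\<forall>i<?s. st (\<rho> \<xi>) u i \<le> ?T"
    unfolding special_def by (auto dest: not_less_Least)
  obtain s' where s': "?s = Suc s'" using 1 T(1) st_0[of "\<rho> \<xi>" u] by (cases ?s) auto
  \<comment> \<open>The preceding round begins by \<open>?T\<close>, so the special one ends by
    \<open>?T + 2 * Tmax = t + Tdiff\<close>.\<close>
  have le: "st (\<rho> \<xi>) u ?s \<le> ?T + Tmax" using 2[rule_format, of s'] st_Suc_le[of "\<rho> \<xi>" u s'] s' by simp
  then show "st (\<rho> \<xi>) u ?s + \<Delta>max \<le> t + Tdiff" "st (\<rho> \<xi>) u ?s < t + Tdiff"
    using T Tdiff by linarith+
  show "st (\<rho> \<xi>) u (Suc ?s) \<le> t + Tdiff"
    using le Tdiff st_Suc_le[of "\<rho> \<xi>" u ?s] by linarith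
  show "t < st \<omega> u ?s" using 1 T(2) st_resample_gt_iff[of \<xi> u ?s] by linarith
qed

lemma special_in_rivals: "w \<in> nbrs A v \<Longrightarrow> (w, special \<xi> w) \<in> rivals u v"
  using fresh_round_bounds[of \<xi> _ "special \<xi> _"] special(5,6) st_resample_gt_iff
  by (auto simp: rivals_def)

text \<open>
  \<open>calm\<close> bounds all rivals, the special round included, so that its probability needs no
  independence; redrawing the \<open>\<ell>\<close>-value of the special round above \<open>j\<close> then turns \<open>calm\<close> into \<open>wins\<close>.
\<close>

definition calm :: "'v \<Rightarrow> 'v \<Rightarrow> nat \<Rightarrow> ('v \<times> nat \<Rightarrow> nat) \<Rightarrow> bool" where
  "calm u v j \<xi> \<longleftrightarrow> (\<forall>r\<in>rivals u v. \<xi> r \<le> j) \<and>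
     (\<forall>w. {w, u} \<in> E \<longrightarrow> \<not> has_joined (\<rho> \<xi>) w (st (\<rho> \<xi>) u (special \<xi> u) + \<Delta>max))"

definition wins :: "'v \<Rightarrow> 'v \<Rightarrow> nat \<Rightarrow> ('v \<times> nat \<Rightarrow> nat) \<Rightarrow> bool" where
  "wins u v j \<xi> \<longleftrightarrow> j < \<xi> (u, special \<xi> u) \<and>
     (\<forall>r\<in>rivals u v - {(u, special \<xi> u)}. \<xi> r \<le> j) \<and> has_joined (\<rho> \<xi>) u (t + Tdiff)"

text \<open>The value of a round does not affect its own start, so round \<open>s\<close> stays
  special. Raising it keeps the neighbours quiet until the song has arrived, and every competitor
  stays at most \<open>j\<close>.\<close>

lemma raise_calm:
  assumes uv: "u \<in> nbrs A v" and ge1: "\<forall>r. 1 \<le> \<xi> r" and calm: "calm u v j \<xi>"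
    and s: "special \<xi> u = s" and m: "j < m"
  shows "wins u v j (\<xi>((u, s) := m))" "special (\<xi>((u, s) := m)) u = s"
proof -
  define \<xi>' where "\<xi>' = \<xi>((u, s) := m)"
  define \<eta> where "\<eta> = \<rho> \<xi>"
  define \<eta>' where "\<eta>' = \<rho> \<xi>'"
  note sp = special[where \<xi> = \<xi> and u = u, unfolded s]
  have \<eta>': "\<eta>' = \<eta>((u, s) := m)"
    unfolding \<eta>'_def \<xi>'_def \<eta>_def using sp(5) by (rule resample_fresh(2))
  have low: "\<xi> r \<le> j" if "r \<in> rivals u v" for r using calm that unfolding calm_def by blast
  have us: "(u, s) \<in> rivals u v" using special_in_rivals[OF uv, of \<xi>] s by simp
  have ge1': "\<forall>r. 1 \<le> \<eta>' r"
    unfolding \<eta>'_def by (rule resample_ge_1) (use ge1 m in \<open>auto simp: \<xi>'_def\<close>)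
  have \<eta>us: "\<eta> (u, s) \<le> m"
    using low[OF us] m resample_fresh(1)[OF sp(5)] by (simp add: \<eta>_def)
  have same: "same_round \<eta> \<eta>' u i" if "i \<le> s" for i
  proof (rule causality)
    show "\<eta>' (v, k) = \<eta> (v, k)" if "st \<eta> v k < st \<eta> u s" for v k
      using that by (auto simp: \<eta>')
    show "st \<eta> u i \<le> st \<eta> u s" using that by (simp add: st_le_iff)
  qed
  have st_eq: "st \<eta>' u i = st \<eta> u i" if "i \<le> s" for i
    using same[OF that] by (simp add: same_round_def)
  show "special (\<xi>((u, s) := m)) u = s"
    unfolding special_def \<xi>'_def[symmetric] \<eta>'_def[symmetric]
  proof (rule Least_equality)
    show "t + 2 * \<Delta>max + Tmax < st \<eta>' u s" using sp(1) st_eq by (simp add: \<eta>_def)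
    fix i assume i: "t + 2 * \<Delta>max + Tmax < st \<eta>' u i"
    show "s \<le> i"
    proof (rule ccontr)
      assume "\<not> s \<le> i"
      then have "i < s" by simp
      with sp(2) st_eq[of i] have "st \<eta>' u i \<le> t + 2 * \<Delta>max + Tmax" by (simp add: \<eta>_def)
      with i show False by simp
    qed
  qed
  then have s': "special \<xi>' u = s" by (simp add: \<xi>'_def)
  have "has_joined \<eta>' u (st \<eta>' u (Suc s))"
  proof (rule loud_round_joins[OF ge1' started_t])
    show "\<not> out_of_play \<eta>' u t"
      using uv by (simp add: \<eta>'_def out_of_play_resample nbrs_A_iff)
    show "t + 2 * \<Delta>max + Tmax < st \<eta>' u s" using sp(1) st_eq by (simp add: \<eta>_def)
    show "\<not> has_joined \<eta>' w (st \<eta>' u s + \<Delta>max)" if "{w, u} \<in> E" for w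
      unfolding st_eq[OF order_refl]
    proof (rule louder_round_quiet[OF \<eta>us \<eta>' _ that])
      show "\<not> has_joined \<eta> w (st \<eta> u s + \<Delta>max)" if "{w, u} \<in> E" for w
        using calm s that unfolding calm_def \<eta>_def by blast
    qed
    \<comment> \<open>Later rounds may shift after the redraw, so membership in the fixed set
      \<open>rivals\<close> is checked in the new run.\<close>
    fix w k assume wk: "{w, u} \<in> E" "\<not> out_of_play \<eta>' w t" "t < st \<eta>' w k" "st \<eta>' w k < st \<eta>' u (Suc s)"
    have "w \<in> nbrs A u"
      using wk uv by (simp add: \<eta>'_def out_of_play_resample nbrs_A_iff)
    moreover have "st \<eta>' w k < t + Tdiff"
      using wk(4) special(4)[where \<xi> = \<xi>' and u = u] by (simp add: s' \<eta>'_def)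
    ultimately have r: "(w, k) \<in> rivals u v"
      using fresh_round_bounds[of \<xi>' w k] wk(3) by (simp add: rivals_def \<eta>'_def)
    have "w \<noteq> u" using card_edge[OF wk(1)] by auto
    moreover have "t < st \<omega> w k" using wk(3) st_resample_gt_iff unfolding \<eta>'_def by blast
    ultimately have "\<eta>' (w, k) = \<xi> (w, k)"
      using resample_fresh(1)[of w k \<xi>] by (simp add: \<eta>' \<eta>_def)
    then show "\<eta>' (w, k) < \<eta>' (u, s)" using low[OF r] m by (simp add: \<eta>')
  qed
  then have "has_joined \<eta>' u (t + Tdiff)"
    using has_joined_mono special(4)[where \<xi> = \<xi>' and u = u] unfolding s' \<eta>'_def by blast
  then show "wins u v j (\<xi>((u, s) := m))"
    using low m unfolding wins_def \<xi>'_def[symmetric] s' \<eta>'_def[symmetric] by (auto simp: \<xi>'_def)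
qed

text \<open>Each special round is a rival of the other, so two wins would give two values each
  larger than the other, whatever the thresholds.\<close>

lemma wins_disjoint:
  assumes "u \<in> nbrs A v" "u' \<in> nbrs A v" "u \<noteq> u'" "wins u v j \<xi>"
  shows "\<not> wins u' v j' \<xi>"
proof
  assume w': "wins u' v j' \<xi>"
  have "\<xi> (u', special \<xi> u') \<le> j"
    using assms special_in_rivals[of u' v \<xi> u] by (auto simp: wins_def)
  moreover have "\<xi> (u, special \<xi> u) \<le> j'"
    using assms w' special_in_rivals[of u v \<xi> u'] by (auto simp: wins_def)
  ultimately show False using assms(4) w' by (simp add: wins_def)
qed

lemma wins_out_of_play:
  assumes "u \<in> nbrs A v" "wins u v j \<xi>"
  shows "out_of_play (\<rho> \<xi>) v (t + Tdiff)"
  using assms unfolding wins_def out_of_play_def nbrs_A_iff by blast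

section \<open>Probabilities of winning and of elimination\<close>

lemma finite_rivals: "finite (rivals u v)"
  by (simp add: rivals_def)

lemma card_rivals_le: "card (rivals u v) \<le> R * (card (nbrs A u) + card (nbrs A v))"
proof -
  have "card (rivals u v) = card (nbrs A u \<union> nbrs A v) * R"
    unfolding rivals_def by (subst card_SigmaI) auto
  also have "\<dots> \<le> (card (nbrs A u) + card (nbrs A v)) * R"
    by (intro mult_right_mono card_Un_le) simp
  finally show ?thesis by (simp add: mult.commute)
qed

lemma ex_horizon:
  obtains J where "finite J" "\<And>\<eta> v i. st \<eta> v i \<le> t + Tdiff \<Longrightarrow> (v, i) \<in> J"
    "\<And>u v. rivals u v \<subseteq> J"
proof -
  obtain N where N: "\<forall>\<eta> v i. st \<eta> v i \<le> t + Tdiff \<longrightarrow> i < N" using ex_round_bound by blast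
  show thesis
    by (rule that[of "UNIV \<times> {..<N} \<union> (\<Union>u v. rivals u v)"])
      (use N in \<open>auto simp: finite_rivals\<close>)
qed

context
  fixes J
  assumes finite_J: "finite J"
    and J_rounds: "\<And>\<eta> v i. st \<eta> v i \<le> t + Tdiff \<Longrightarrow> (v, i) \<in> J"
    and J_rivals: "\<And>u v. rivals u v \<subseteq> J"
begin

text \<open>The default 1 keeps values outside \<open>J\<close> positive, as the lemmas on runs
  require.\<close>

abbreviation "P \<equiv> Pi_pmf J 1 (\<lambda>_. ell_pmf)"
abbreviation "q v \<equiv> measure_pmf.prob P {\<xi>. out_of_play (\<rho> \<xi>) v (t + Tdiff)}"

lemma P_ge_1:
  assumes "\<xi> \<in> set_pmf P"
  shows "\<forall>r. 1 \<le> \<xi> r"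
proof
  fix r
  have "\<xi> \<in> PiE_dflt J 1 (\<lambda>_. set_pmf ell_pmf)"
    using assms set_Pi_pmf[OF finite_J, of 1 "\<lambda>_. ell_pmf"] by (simp only: o_def)
  then have "(r \<in> J \<longrightarrow> \<xi> r \<in> set_pmf ell_pmf) \<and> (r \<notin> J \<longrightarrow> \<xi> r = 1)"
    unfolding PiE_dflt_def by blast
  then show "1 \<le> \<xi> r"
    using ell_pmf_ge_1[of "\<xi> r"] by (cases "r \<in> J") auto
qed

text \<open>The index of the special round is random; fixing it gives a definite coordinate to
  redraw.\<close>

lemma prob_split_special:
  "measure_pmf.prob P {\<xi>. Q \<xi>} = (\<Sum>s | (u, s) \<in> J. measure_pmf.prob P {\<xi>. Q \<xi> \<and> special \<xi> u = s})"
proof -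
  have fin: "finite {s. (u, s) \<in> J}"
    by (rule finite_subset[of _ "snd ` J"]) (use finite_J in force)+
  have "{\<xi>. Q \<xi>} = (\<Union>s\<in>{s. (u, s) \<in> J}. {\<xi>. Q \<xi> \<and> special \<xi> u = s})"
    using J_rounds[OF less_imp_le[OF special(6)]] by auto
  also have "measure_pmf.prob P \<dots> = (\<Sum>s | (u, s) \<in> J. measure_pmf.prob P {\<xi>. Q \<xi> \<and> special \<xi> u = s})"
    using fin by (intro measure_pmf.finite_measure_finite_Union) (auto simp: disjoint_family_on_def)
  finally show ?thesis .
qed

text \<open>Redrawing keeps the special index, so the bounds for each \<open>s\<close> add up
  without overlap.\<close>

lemma prob_wins_ge_calm:
  assumes "u \<in> nbrs A v"
  shows "(1 / 2) ^ j * measure_pmf.prob P {\<xi>. calm u v j \<xi>} \<le> measure_pmf.prob P {\<xi>. wins u v j \<xi>}"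
proof -
  have "(1 / 2) ^ j * measure_pmf.prob P {\<xi>. calm u v j \<xi> \<and> special \<xi> u = s}
      \<le> measure_pmf.prob P {\<xi>. wins u v j \<xi> \<and> special \<xi> u = s}" if "(u, s) \<in> J" for s
    unfolding ell_pmf_tail[symmetric]
  proof (rule prob_Pi_pmf_resample_ge[OF finite_J that])
    fix \<xi> m
    assume "\<xi> \<in> set_pmf P" "\<xi> \<in> {\<xi>. calm u v j \<xi> \<and> special \<xi> u = s}" "m \<in> {n. j < n}"
    with raise_calm[OF assms P_ge_1[of \<xi>], of j s m]
    show "\<xi>((u, s) := m) \<in> {\<xi>. wins u v j \<xi> \<and> special \<xi> u = s}" by blast
  qed
  then show ?thesis
    unfolding prob_split_special[of "calm u v j" u] prob_split_special[of "wins u v j" u]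
      sum_distrib_left
    by (intro sum_mono) simp
qed

text \<open>Union bound: \<open>calm\<close> fails only if some rival exceeds \<open>j\<close>, or a
  neighbour joins and puts \<open>u\<close> out of play by \<open>t + Tdiff\<close>.\<close>

lemma prob_calm_ge:
  assumes "2 * card (rivals u v) \<le> 2 ^ j"
  shows "1 / 2 - q u \<le> measure_pmf.prob P {\<xi>. calm u v j \<xi>}"
proof -
  let ?out = "{\<xi>. out_of_play (\<rho> \<xi>) u (t + Tdiff)}"
  have "UNIV \<subseteq> {\<xi>. calm u v j \<xi>} \<union> ((\<Union>r\<in>rivals u v. {\<xi>. j < \<xi> r}) \<union> ?out)"
    using has_joined_mono[OF _ special(3)]
    by (auto simp: calm_def out_of_play_def not_le)
  then have "1 \<le> measure_pmf.prob P ({\<xi>. calm u v j \<xi>} \<union> ((\<Union>r\<in>rivals u v. {\<xi>. j < \<xi> r}) \<union> ?out))"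
    by (metis measure_pmf.prob_space top.extremum_uniqueI space_measure_pmf order_refl)
  also have "\<dots> \<le> measure_pmf.prob P {\<xi>. calm u v j \<xi>} +
      (measure_pmf.prob P (\<Union>r\<in>rivals u v. {\<xi>. j < \<xi> r}) + q u)"
    by (intro order_trans[OF measure_Un_le] add_mono order_refl) auto
  also have "measure_pmf.prob P (\<Union>r\<in>rivals u v. {\<xi>. j < \<xi> r})
      \<le> (\<Sum>r\<in>rivals u v. measure_pmf.prob P {\<xi>. j < \<xi> r})"
    by (intro measure_pmf.finite_measure_subadditive_finite finite_rivals) auto
  also have "\<dots> = card (rivals u v) * (1 / 2) ^ j"
    using prob_Pi_pmf_tail[OF finite_J subsetD[OF J_rivals]] by simp
  also have "\<dots> \<le> 1 / 2"
  proof -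
    have "2 * real (card (rivals u v)) \<le> 2 ^ j"
      using of_nat_mono[OF assms, where 'a = real] by simp
    then show ?thesis by (simp add: power_divide field_simps)
  qed
  finally show ?thesis by simp
qed

text \<open>
  With \<open>n\<close> rivals and \<open>2 * n \<le> 2 ^ j \<le> 4 * n\<close>, the union bound loses at most \<open>1 / 2\<close>, while a given
  \<open>\<ell>\<close>-value exceeds \<open>j\<close> with probability at least \<open>1 / (4 * n)\<close>.
\<close>

lemma ex_threshold:
  assumes uv: "u \<in> nbrs A v"
  shows "\<exists>j. 1 / (4 * real R) * (1 / 2 - q u) / (real (card (nbrs A u)) + real (card (nbrs A v)))
    \<le> measure_pmf.prob P {\<xi>. wins u v j \<xi>}"
proof -
  define n where "n = R * (card (nbrs A u) + card (nbrs A v))"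
  have "(u, special undefined u) \<in> rivals u v" by (rule special_in_rivals[OF uv])
  then have "0 < card (rivals u v)" using finite_rivals by (auto simp: card_gt_0_iff)
  moreover have "card (rivals u v) \<le> n" unfolding n_def by (rule card_rivals_le)
  ultimately have n: "0 < n" "card (rivals u v) \<le> n" by linarith+
  then obtain j where j: "2 * n \<le> 2 ^ j" "2 ^ j \<le> 4 * n"
    using power_of_two_between[of "2 * n"] by auto
  have p: "1 / (4 * real n) \<le> (1 / 2) ^ j"
  proof -
    have "2 ^ j \<le> 4 * real n" using of_nat_mono[OF j(2), where 'a = real] by simp
    then show ?thesis using n by (simp add: power_divide field_simps)
  qed
  have "1 / (4 * real n) * (1 / 2 - q u) \<le> measure_pmf.prob P {\<xi>. wins u v j \<xi>}"
  proof (cases "0 \<le> 1 / 2 - q u")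
    case True
    then have "1 / (4 * real n) * (1 / 2 - q u) \<le> (1 / 2) ^ j * (1 / 2 - q u)"
      using p by (rule mult_right_mono[rotated])
    also have "\<dots> \<le> (1 / 2) ^ j * measure_pmf.prob P {\<xi>. calm u v j \<xi>}"
      using prob_calm_ge[of u v j] j n by (intro mult_left_mono) auto
    also note prob_wins_ge_calm[OF uv]
    finally show ?thesis .
  next
    case False
    then have "1 / (4 * real n) * (1 / 2 - q u) \<le> 0"
      by (intro mult_nonneg_nonpos) auto
    also have "0 \<le> measure_pmf.prob P {\<xi>. wins u v j \<xi>}" by simp
    finally show ?thesis .
  qed
  then show ?thesis by (auto simp: n_def field_simps)
qed

text \<open>Wins of different neighbours are disjoint even with different thresholds, and each puts
  \<open>v\<close> out of play.\<close>

lemma q_ge: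
  "(\<Sum>u\<in>nbrs A v. 1 / (4 * real R) * (1 / 2 - q u) / (real (card (nbrs A u)) + real (card (nbrs A v)))) \<le> q v"
proof -
  have "\<forall>u\<in>nbrs A v. \<exists>j. 1 / (4 * real R) * (1 / 2 - q u) / (real (card (nbrs A u)) + real (card (nbrs A v)))
      \<le> measure_pmf.prob P {\<xi>. wins u v j \<xi>}"
    using ex_threshold by blast
  from bchoice[OF this] obtain j where j: "\<And>u. u \<in> nbrs A v \<Longrightarrow>
      1 / (4 * real R) * (1 / 2 - q u) / (real (card (nbrs A u)) + real (card (nbrs A v)))
        \<le> measure_pmf.prob P {\<xi>. wins u v (j u) \<xi>}"
    by blast
  then have "(\<Sum>u\<in>nbrs A v. 1 / (4 * real R) * (1 / 2 - q u) / (real (card (nbrs A u)) + real (card (nbrs A v))))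
      \<le> (\<Sum>u\<in>nbrs A v. measure_pmf.prob P {\<xi>. wins u v (j u) \<xi>})"
    by (rule sum_mono)
  also have "\<dots> = measure_pmf.prob P (\<Union>u\<in>nbrs A v. {\<xi>. wins u v (j u) \<xi>})"
  proof (rule measure_pmf.finite_measure_finite_Union[symmetric])
    show "disjoint_family_on (\<lambda>u. {\<xi>. wins u v (j u) \<xi>}) (nbrs A v)"
      unfolding disjoint_family_on_def using wins_disjoint by blast
  qed simp_all
  also have "\<dots> \<le> q v"
    by (rule measure_pmf.finite_measure_mono) (use wins_out_of_play in blast, simp)
  finally show ?thesis .
qed

section \<open>From agents to edges\<close>

abbreviation "active_later \<xi> \<equiv> active_edges E (X (\<rho> \<xi>)) (t + Tdiff)"
abbreviation "Z e \<equiv> measure_pmf.prob P {\<xi>. e \<notin> active_later \<xi>}"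

lemma active_later_iff:
  assumes "\<forall>r. 1 \<le> \<xi> r"
  shows "e \<in> active_later \<xi> \<longleftrightarrow> e \<in> E \<and> (\<forall>v\<in>e. \<not> out_of_play (\<rho> \<xi>) v (t + Tdiff))"
  using in_active_edges_iff[OF resample_ge_1[OF assms]] Tdiff_pos by simp

lemma active_later_subset:
  assumes "\<forall>r. 1 \<le> \<xi> r"
  shows "active_later \<xi> \<subseteq> A"
proof
  fix e assume "e \<in> active_later \<xi>"
  then have e: "e \<in> E" "\<forall>v\<in>e. \<not> out_of_play (\<rho> \<xi>) v (t + Tdiff)"
    by (auto simp: active_later_iff[OF assms])
  then have "\<forall>v\<in>e. \<not> out_of_play (\<rho> \<xi>) v t"
    using out_of_play_mono[of "\<rho> \<xi>" _ t "t + Tdiff"] Tdiff_pos by auto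
  with e show "e \<in> A"
    by (simp add: in_active_edges_iff[OF history order_refl] out_of_play_resample)
qed

lemma q_le_Z:
  assumes "v \<in> e"
  shows "q v \<le> Z e"
proof (rule measure_pmf.finite_measure_mono_AE)
  have "e \<notin> active_later \<xi>" if "\<xi> \<in> set_pmf P" "out_of_play (\<rho> \<xi>) v (t + Tdiff)" for \<xi>
    using active_later_iff[OF P_ge_1[OF that(1)]] assms that(2) by blast
  then show "AE \<xi> in P. \<xi> \<in> {\<xi>. out_of_play (\<rho> \<xi>) v (t + Tdiff)} \<longrightarrow> \<xi> \<in> {\<xi>. e \<notin> active_later \<xi>}"
    by (simp add: AE_measure_pmf_iff)
qed simp

lemma expected_active_later:
  "measure_pmf.expectation P (\<lambda>\<xi>. real (card (active_later \<xi>))) = card A - sum Z A"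
proof -
  have count: "real (card (active_later \<xi>)) = (\<Sum>e\<in>A. indicator {\<xi>. e \<in> active_later \<xi>} \<xi>)"
    if "\<xi> \<in> set_pmf P" for \<xi>
  proof -
    have "A \<inter> active_later \<xi> = active_later \<xi>"
      using active_later_subset[OF P_ge_1[OF that]] by blast
    then have "real (card (active_later \<xi>)) = (\<Sum>e\<in>A \<inter> active_later \<xi>. 1)" by simp
    also have "\<dots> = (\<Sum>e\<in>A. if e \<in> active_later \<xi> then 1 else 0)"
      by (rule sum.inter_restrict) simp
    also have "\<dots> = (\<Sum>e\<in>A. indicator {\<xi>. e \<in> active_later \<xi>} \<xi>)"
      by (rule sum.cong) (auto simp: indicator_def)
    finally show ?thesis .
  qed
  have "measure_pmf.expectation P (\<lambda>\<xi>. real (card (active_later \<xi>))) =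
      measure_pmf.expectation P (\<lambda>\<xi>. \<Sum>e\<in>A. indicator {\<xi>. e \<in> active_later \<xi>} \<xi>)"
    by (rule integral_cong_AE) (use count in \<open>simp_all add: AE_measure_pmf_iff\<close>)
  also have "\<dots> = (\<Sum>e\<in>A. measure_pmf.expectation P (indicator {\<xi>. e \<in> active_later \<xi>}))"
    by (rule Bochner_Integration.integral_sum) (simp add: measure_pmf.emeasure_eq_measure)
  also have "\<dots> = (\<Sum>e\<in>A. 1 - Z e)"
  proof (rule sum.cong)
    fix e
    have "UNIV - {\<xi>. e \<in> active_later \<xi>} = {\<xi>. e \<notin> active_later \<xi>}" by auto
    then show "measure_pmf.expectation P (indicator {\<xi>. e \<in> active_later \<xi>}) = 1 - Z e"
      using measure_pmf.prob_compl[of "{\<xi>. e \<in> active_later \<xi>}" P] by simp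
  qed simp
  finally show ?thesis by (simp add: sum_subtractf)
qed

lemma sum_Z_ge: "card A / 28 * (Tmin / Tdiff) \<le> sum Z A"
proof -
  define x where "x = Tdiff / Tmin"
  have x: "3 \<le> x"
    using Tdiff_ge delay_bound_nonneg Tmin_pos by (simp add: x_def field_simps)
  have R: "0 < R" "real R \<le> x + 1"
    using x by (auto simp: R_def x_def)
  have "1 / (4 * real R) * (card A / 2 - sum Z A) \<le> 2 * sum Z A"
  proof (rule sum_edges_lower_bound[where q = q])
    fix v
    have "(\<Sum>u\<in>nbrs A v. 1 / (4 * real R) * (1 / 2 - Z {u, v}) / (real (card (nbrs A u)) + real (card (nbrs A v))))
      \<le> (\<Sum>u\<in>nbrs A v. 1 / (4 * real R) * (1 / 2 - q u) / (real (card (nbrs A u)) + real (card (nbrs A v))))"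
    proof (intro sum_mono divide_right_mono mult_left_mono)
      show "1 / 2 - Z {u, v} \<le> 1 / 2 - q u" for u
        using q_le_Z[of u "{u, v}"] by simp
    qed auto
    also note q_ge
    finally show "(\<Sum>u\<in>nbrs A v. 1 / (4 * real R) * (1 / 2 - Z {u, v}) / (real (card (nbrs A u)) + real (card (nbrs A v)))) \<le> q v" .
  qed (use card_A q_le_Z in auto)
  then have "card A / 2 - sum Z A \<le> 8 * real R * sum Z A"
    using R by (simp add: field_simps)
  also have "\<dots> \<le> 8 * (x + 1) * sum Z A"
    using R by (intro mult_right_mono sum_nonneg) auto
  finally have "card A / 2 \<le> (8 * x + 9) * sum Z A" by (simp add: algebra_simps)
  \<comment> \<open>\<open>3 \<le> x\<close> gives \<open>9 \<le> 6 * x\<close>; the constant 28 is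
    twice 14.\<close>
  also have "\<dots> \<le> 14 * x * sum Z A"
    using x by (intro mult_right_mono sum_nonneg) auto
  finally have "card A / (28 * x) \<le> sum Z A"
    using x by (simp add: field_simps)
  then show ?thesis by (simp add: x_def)
qed

text \<open>By causality the states at \<open>t + Tdiff\<close> are determined by rounds begun
  earlier, all of which lie in \<open>J\<close>.\<close>

lemma active_later_cong:
  assumes "\<And>r. r \<in> J \<Longrightarrow> \<xi> r = \<xi>' r"
  shows "active_later \<xi> = active_later \<xi>'"
proof -
  have agree: "\<rho> \<xi>' (v, i) = \<rho> \<xi> (v, i)" if "st (\<rho> \<xi>) v i < t + Tdiff" for v i
    using assms[OF J_rounds[OF less_imp_le[OF that]]] by (simp add: resample_after_def)
  have "state_at (X (\<rho> \<xi>')) v (t + Tdiff) = state_at (X (\<rho> \<xi>)) v (t + Tdiff)" for v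
  proof -
    have "st (\<rho> \<xi>) v 0 \<le> t + Tdiff" using started_t[of v] Tdiff_pos by (simp add: st_0)
    then obtain i where i: "st (\<rho> \<xi>) v i \<le> t + Tdiff" "t + Tdiff < st (\<rho> \<xi>) v (Suc i)"
      using ex_round by blast
    have same: "same_round (\<rho> \<xi>) (\<rho> \<xi>') v i"
      using causality[of "\<rho> \<xi>" "t + Tdiff" "\<rho> \<xi>'"] agree i(1) by blast
    show ?thesis
      using state_at_eq[OF i] state_at_eq[of "\<rho> \<xi>'" v i "t + Tdiff"] i same same_round_end[OF same]
      by (simp add: same_round_def)
  qed
  then show ?thesis by (simp add: active_edges_def eliminated_def lone_In_def)
qed

lemma active_edges_decrease_aux:
  "card A / 28 * (Tmin / Tdiff) \<le> card A - (\<integral>\<xi>. real (card (active_later \<xi>)) \<partial>ell_measure)"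
proof -
  have "(\<integral>\<xi>. real (card (active_later \<xi>)) \<partial>ell_measure) =
      measure_pmf.expectation P (\<lambda>\<xi>. real (card (active_later \<xi>)))"
    by (rule integral_ell_measure_eq_expectation[OF finite_J]) (metis active_later_cong)
  with sum_Z_ge show ?thesis unfolding expected_active_later by linarith
qed

end

lemma active_edges_decrease:
  "real (card A) / 28 * (Tmin / Tdiff) \<le>
     real (card A) - (\<integral>\<xi>. real (card (active_edges E (X (\<rho> \<xi>)) (t + Tdiff))) \<partial>ell_measure)"
proof (rule ex_horizon)
  fix J assume "finite J" "\<And>\<eta> v i. st \<eta> v i \<le> t + Tdiff \<Longrightarrow> (v, i) \<in> J" "\<And>u v. rivals u v \<subseteq> J"
  then show ?thesis by (rule active_edges_decrease_aux)
qed

end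

theorem theorem3:
  fixes E :: "'v::finite set set"
    and delay :: "'v \<Rightarrow> 'v \<Rightarrow> real \<Rightarrow> real"
    and t0 :: "'v \<Rightarrow> real"
    and dur :: "'v \<Rightarrow> (agent_state \<times> nat \<times> nat set) list \<Rightarrow> real"
    and X :: "('v \<times> nat \<Rightarrow> nat) \<Rightarrow> 'v execution"
    and Tmin Tmax \<Delta>max Tdiff t :: real
    and \<omega> :: "'v \<times> nat \<Rightarrow> nat"
  assumes edges: "\<And>e. e \<in> E \<Longrightarrow> card e = 2"
    and delays: "\<And>u v \<tau>. {u, v} \<in> E \<Longrightarrow> 0 \<le> delay u v \<tau> \<and> delay u v \<tau> \<le> \<Delta>max"
    and durations: "\<And>v h. Tmin \<le> dur v h \<and> dur v h \<le> Tmax"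
    and Tmin_pos: "0 < Tmin"
    and delay_bound: "2 * \<Delta>max \<le> Tmin"
    and Tdiff: "Tdiff = 2 * \<Delta>max + 3 * Tmax"
    and started: "\<And>v. t0 v \<le> 0"
    and runs: "\<And>\<eta>. is_execution E delay t0 dur \<eta> (X \<eta>)"
    and time: "0 \<le> t"
    and history: "\<And>r. 1 \<le> \<omega> r"
  shows "real (card (active_edges E (X \<omega>) t))
           - (\<integral>\<omega>'. real (card (active_edges E (X (resample_after t (X \<omega>) \<omega> \<omega>')) (t + Tdiff)))
                \<partial>ell_measure)
         \<ge> real (card (active_edges E (X \<omega>) t)) / 28 * (Tmin / Tdiff)"
proof (cases "E = {}")
  case True
  then show ?thesis by (simp add: active_edges_def)
next
  case False
  then obtain e where "e \<in> E" by blast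
  moreover from edges[OF this] obtain a b where "e = {a, b}" by (auto simp: card_2_iff)
  ultimately have "{a, b} \<in> E" by simp
  \<comment> \<open>Only an actual edge makes \<open>delays\<close> bound \<open>\<Delta>max\<close>
    from below, hence the separate edgeless case.\<close>
  then have "0 \<le> \<Delta>max" using delays[of a b 0] by linarith
  then interpret singing_snapshot E delay t0 dur X Tmin Tmax \<Delta>max Tdiff t \<omega>
    using assms by unfold_locales auto
  show ?thesis by (rule active_edges_decrease)
qed

end
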